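(* Let $d\ge1$ and $\lambda>0$. On the network $\Gamma_d(\lambda)$ the wired and free uniform spanning forest measures coincide: $\mathsf{WSF}=\mathsf{FSF}$.
   Context: $\Gamma_d(\lambda)$ is the nearest-neighbour lattice graph on $\mathbb{Z}^{d+1}=\mathbb{Z}\times\mathbb{Z}^d$ with conductance $\mu((n,x),(n',x'))=e^{\lambda\max(n,n')}$ on each edge $(n,x)\sim(n',x')$. On a finite connected network, the uniform spanning tree is the random spanning tree whose probability of being $t$ is proportional to the product of the conductances of the edges of $t$. On an infinite network, take an exhaustion by an increasing sequence of finite connected vertex sets $V_q$. The free uniform spanning forest measure $\mathsf{FSF}$ is the weak limit of the uniform spanning tree measures of the networks induced on $V_q$; the wired uniform spanning forest measure $\mathsf{WSF}$ is the weak limit of the uniform spanning tree measures of the networks obtained from $V_q$ by identifying (wiring) all vertices of its exterior boundary into a single vertex. Both limits exist and do not depend on the exhaustion. *)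

theory Defs
  imports "HOL-Probability.Probability" "HOL-Library.Uprod"
begin

text \<open>
  Networks are multigraphs: identifying vertices may create parallel edges and loops, so edges
  have an identity of their own and \<open>ends\<close> gives the unordered pair of their endpoints.
\<close>

record ('v, 'e) network =
  verts :: "'v set"
  edges :: "'e set"
  ends :: "'e \<Rightarrow> 'v uprod"
  cond :: "'e \<Rightarrow> real"

definition connects :: "('v, 'e) network \<Rightarrow> 'e set \<Rightarrow> bool" where
  "connects N F \<longleftrightarrow>
    (\<forall>x\<in>verts N. \<forall>y\<in>verts N. (x, y) \<in> {(u, v). \<exists>e\<in>F. ends N e = Upair u v}\<^sup>*)"

definition connected_network :: "('v, 'e) network \<Rightarrow> bool" where
  "connected_network N \<longleftrightarrow> verts N \<noteq> {} \<and> connects N (edges N)"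

text \<open>
  A cycle visits the distinct vertices \<open>vs\<close> in cyclic order along the distinct edges \<open>es\<close>. A loop
  is a cycle of length one, and two parallel edges form a cycle of length two.
\<close>

definition is_cycle :: "('v, 'e) network \<Rightarrow> 'v list \<Rightarrow> 'e list \<Rightarrow> bool" where
  "is_cycle N vs es \<longleftrightarrow>
    vs \<noteq> [] \<and> length es = length vs \<and> distinct vs \<and> distinct es \<and>
    (\<forall>i<length vs. ends N (es ! i) = Upair (vs ! i) (vs ! (Suc i mod length vs)))"

definition acyclic_edges :: "('v, 'e) network \<Rightarrow> 'e set \<Rightarrow> bool" where
  "acyclic_edges N F \<longleftrightarrow> (\<nexists>vs es. is_cycle N vs es \<and> set es \<subseteq> F)"

definition spanning_trees :: "('v, 'e) network \<Rightarrow> 'e set set" where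
  "spanning_trees N = {t. t \<subseteq> edges N \<and> connects N t \<and> acyclic_edges N t}"

definition tree_weight :: "('v, 'e) network \<Rightarrow> 'e set \<Rightarrow> real" where
  "tree_weight N t = (\<Prod>e\<in>t. cond N e)"

text \<open>
  For a finite connected network with positive conductances the quotients sum to one, so that
  \<open>embed_pmf\<close> is meaningful.
\<close>

definition UST :: "('v, 'e) network \<Rightarrow> 'e set pmf" where
  "UST N = embed_pmf (\<lambda>t. if t \<in> spanning_trees N
      then tree_weight N t / (\<Sum>s\<in>spanning_trees N. tree_weight N s) else 0)"

text \<open>
  Random edge sets are compared through their indicator functions, in the space \<open>'e \<Rightarrow> bool\<close> with
  its product topology. For a countable edge type the Borel sets of this space are generated by
  the cylinder events.
\<close>

definition UST_law :: "('v, 'e) network \<Rightarrow> ('e \<Rightarrow> bool) measure" where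
  "UST_law N = distr (measure_pmf (UST N)) borel (\<lambda>t e. e \<in> t)"

instance uprod :: (countable) countable
proof
  have "inj (\<lambda>p :: 'a uprod. inv (case_prod Upair) p)"
    by (rule surj_imp_inj_inv) (auto simp: surj_def intro: uprod_exhaust)
  then have "inj (to_nat \<circ> inv (case_prod Upair) :: 'a uprod \<Rightarrow> nat)"
    using inj_compose[OF inj_to_nat] by (simp add: comp_def)
  then show "\<exists>f :: 'a uprod \<Rightarrow> nat. inj f"
    by blast
qed

definition weakly_converges ::
    "(nat \<Rightarrow> 'a :: topological_space measure) \<Rightarrow> 'a measure \<Rightarrow> bool" where
  "weakly_converges \<mu> M \<longleftrightarrow>
    (\<forall>f :: 'a \<Rightarrow> real. continuous_on UNIV f \<longrightarrow> bounded (range f) \<longrightarrow>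
      (\<lambda>q. integral\<^sup>L (\<mu> q) f) \<longlonglongrightarrow> integral\<^sup>L M f)"

definition induced :: "('v, 'e) network \<Rightarrow> 'v set \<Rightarrow> ('v, 'e) network" where
  "induced N V = N\<lparr>verts := V, edges := {e \<in> edges N. set_uprod (ends N e) \<subseteq> V}\<rparr>"

definition ext_boundary :: "('v, 'e) network \<Rightarrow> 'v set \<Rightarrow> 'v set" where
  "ext_boundary N V =
    {y \<in> verts N - V. \<exists>x\<in>V. \<exists>e\<in>edges N. ends N e = Upair x y}"

definition map_verts :: "('v \<Rightarrow> 'w) \<Rightarrow> ('v, 'e) network \<Rightarrow> ('w, 'e) network" where
  "map_verts \<pi> N =
    \<lparr>verts = \<pi> ` verts N, edges = edges N, ends = (\<lambda>e. map_uprod \<pi> (ends N e)), cond = cond N\<rparr>"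

text \<open>
  The vertex \<open>None\<close> is the one into which the exterior boundary is wired. Edges between two
  boundary vertices become loops, which belong to no spanning tree.
\<close>

definition wired :: "('v, 'e) network \<Rightarrow> 'v set \<Rightarrow> ('v option, 'e) network" where
  "wired N V =
    map_verts (\<lambda>v. if v \<in> V then Some v else None) (induced N (V \<union> ext_boundary N V))"

definition exhaustion :: "('v, 'e) network \<Rightarrow> (nat \<Rightarrow> 'v set) \<Rightarrow> bool" where
  "exhaustion N V \<longleftrightarrow>
    (\<forall>q. finite (V q) \<and> connected_network (induced N (V q))) \<and>
    incseq V \<and> (\<Union>q. V q) = verts N"

definition is_FSF :: "('v, 'e) network \<Rightarrow> ('e \<Rightarrow> bool) measure \<Rightarrow> bool" where
  "is_FSF N M \<longleftrightarrow> prob_space M \<and> sets M = sets borel \<and>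
    (\<forall>V. exhaustion N V \<longrightarrow> weakly_converges (\<lambda>q. UST_law (induced N (V q))) M)"

definition is_WSF :: "('v, 'e) network \<Rightarrow> ('e \<Rightarrow> bool) measure \<Rightarrow> bool" where
  "is_WSF N M \<longleftrightarrow> prob_space M \<and> sets M = sets borel \<and>
    (\<forall>V. exhaustion N V \<longrightarrow> weakly_converges (\<lambda>q. UST_law (wired N (V q))) M)"

text \<open>
  The descriptions below are informative only together with existence of the limits, that is
  \<open>is_FSF N (FSF N)\<close> and \<open>is_WSF N (WSF N)\<close>; weak limits are unique for a countable edge type.
\<close>

definition FSF :: "('v, 'e) network \<Rightarrow> ('e \<Rightarrow> bool) measure" where
  "FSF N = (THE M. is_FSF N M)"

definition WSF :: "('v, 'e) network \<Rightarrow> ('e \<Rightarrow> bool) measure" where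
  "WSF N = (THE M. is_WSF N M)"

text \<open>
  The dimension \<open>d\<close> is \<open>CARD('d)\<close>, which is at least one. The product \<open>\<int> \<times> \<int>\<^sup>d\<close> is the type
  \<open>int \<times> (int ^ 'd)\<close>, and vertices are neighbours when their \<open>\<ell>\<^sup>1\<close>-distance is one.
\<close>

definition lattice_adj :: "int \<times> (int ^ 'd) \<Rightarrow> int \<times> (int ^ 'd) \<Rightarrow> bool" where
  "lattice_adj u v \<longleftrightarrow>
    \<bar>fst u - fst v\<bar> + (\<Sum>i\<in>UNIV. \<bar>snd u $ i - snd v $ i\<bar>) = 1"

definition lattice_network ::
    "'d itself \<Rightarrow> real \<Rightarrow> (int \<times> (int ^ 'd), (int \<times> (int ^ 'd)) uprod) network" where
  "lattice_network _ lam =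
    \<lparr>verts = UNIV,
     edges = {Upair u v | u v. lattice_adj u v},
     ends = id,
     cond = (\<lambda>e. exp (lam * of_int (Max (fst ` set_uprod e))))\<rparr>"

end

theory Submission
  imports Defs
begin

text \<open>
  Kirchhoff's formula writes \<open>P(e \<in> T)\<close> in a finite network as \<open>c e\<close> divided by the effective
  conductance between the ends of \<open>e\<close>. Doubling the conductances of the edges of a finite set
  \<open>S\<close> one after the other turns \<open>E(2 ^ card (T \<inter> S))\<close> into a product of factors
  \<open>1 + P(e \<in> T)\<close>, and these expectations determine the law of \<open>T\<close>. Hence both forest measures
  exist and coincide as soon as, after every such finite change of conductances, free and wired
  effective conductances have the same limit, and for this it suffices that each function of
  finite Dirichlet energy is approximated in energy by functions constant off a finite set.

  On the lattice the conductances grow exponentially along the rays \<open>n \<mapsto> (n, x)\<close>, so a function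
  \<open>g\<close> of finite energy converges along every ray. The horizontal edges force a common limit \<open>k\<close>,
  and \<open>(\<Sum>x. exp (lam * n) * (g (n, x) - k)\<^sup>2)\<close> is bounded uniformly in \<open>n\<close>. Multiplying \<open>g - k\<close>
  by a linear cutoff at scale \<open>r\<close> therefore costs an energy of order \<open>1 / r\<close>.
\<close>

subsection \<open>Trees and two-component forests of a finite network\<close>

text \<open>Doubling is used instead of deletion and contraction because it leaves vertices and
  edges unchanged: every intermediate network is the original one with conductances larger by a
  factor between one and two, so a single approximation property serves all steps. Free conductances
  lie below the limiting value and wired ones above it. The free ones reach it by compactness alone;
  only the wired ones need the density. A function that is constant off a finite set descends to the
  wired network as soon as that set lies in the exhausting set, and the requirement that
  approximation fixes values on a given finite set preserves the unit difference across the tested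
  edge. On the lattice the danger is that a cutoff at scale \<open>r\<close> has derivative
  \<open>1 / r\<close> on a region of volume of order \<open>r ^ (d + 1)\<close>. The uniform bound
  on each level removes the dimension: a ball of radius \<open>r\<close> meets only about
  \<open>2 * r\<close> levels, so the weighted sum of squares over the ball grows linearly and its
  product with \<open>1 / r ^ 2\<close> vanishes.\<close>

definition reach :: "('v, 'e) network \<Rightarrow> 'e set \<Rightarrow> ('v \<times> 'v) set" where
  "reach N F = {(u, v). \<exists>e\<in>F. ends N e = Upair u v}\<^sup>*"

lemma connects_iff: "connects N F \<longleftrightarrow> (\<forall>x\<in>verts N. \<forall>y\<in>verts N. (x, y) \<in> reach N F)"
  by (simp add: connects_def reach_def)

lemma reach_refl [simp, intro]: "(x, x) \<in> reach N F"
  by (simp add: reach_def)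

lemma reach_edge: "e \<in> F \<Longrightarrow> ends N e = Upair u v \<Longrightarrow> (u, v) \<in> reach N F"
  unfolding reach_def by (rule r_into_rtrancl) auto

lemma reach_trans: "(x, y) \<in> reach N F \<Longrightarrow> (y, z) \<in> reach N F \<Longrightarrow> (x, z) \<in> reach N F"
  unfolding reach_def by (rule rtrancl_trans)

lemma reach_sym: "(x, y) \<in> reach N F \<Longrightarrow> (y, x) \<in> reach N F"
proof -
  have "sym {(u, v). \<exists>e\<in>F. ends N e = Upair u v}"
    by (rule symI) (force simp: Upair_inject)
  then show "(x, y) \<in> reach N F \<Longrightarrow> (y, x) \<in> reach N F"
    unfolding reach_def by (meson sym_rtrancl symD)
qed

lemma reach_mono: "F \<subseteq> G \<Longrightarrow> (x, y) \<in> reach N F \<Longrightarrow> (x, y) \<in> reach N G"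
  unfolding reach_def by (erule rtrancl_mono[THEN subsetD, rotated]) auto

text \<open>Turns reasoning about the equivalence relation into equational reasoning.\<close>

lemma reach_comp: "(x, y) \<in> reach N F \<longleftrightarrow> reach N F `` {x} = reach N F `` {y}"
  by (blast intro: reach_refl reach_sym reach_trans)

lemma reach_induct [consumes 1, case_names refl step]:
  assumes "(x, y) \<in> reach N F" "P x"
    and "\<And>y z e. (x, y) \<in> reach N F \<Longrightarrow> e \<in> F \<Longrightarrow> ends N e = Upair y z \<Longrightarrow> P y \<Longrightarrow> P z"
  shows "P y"
  using assms(1)[unfolded reach_def] assms(2)
proof (induction rule: rtrancl_induct)
  case (step y z)
  then show ?case using assms(3)[of y _ z] by (auto simp: reach_def)
qed

lemma reach_insert:
  assumes "(a, b) \<in> reach N (insert e F)" "ends N e = Upair u v"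
  shows "(a, b) \<in> reach N F \<or> (a, u) \<in> reach N F \<and> (v, b) \<in> reach N F
    \<or> (a, v) \<in> reach N F \<and> (u, b) \<in> reach N F"
  using assms(1)
proof (induction rule: reach_induct)
  case (step y z f)
  show ?case
  proof (cases "f = e")
    case True
    then have "y = u \<and> z = v \<or> y = v \<and> z = u" using step assms(2) by auto
    then show ?thesis using step.IH by (auto simp: reach_comp)
  next
    case False
    then have "(y, z) \<in> reach N F" using step by (auto intro: reach_edge)
    then show ?thesis using step.IH by (simp add: reach_comp)
  qed
qed simp

text \<open>Acyclicity expressed through reachability, which insertion and deletion of edges can
  handle directly. Loops are excluded too, since reachability is reflexive.\<close>

definition bridges :: "('v, 'e) network \<Rightarrow> 'e set \<Rightarrow> bool" where
  "bridges N F \<longleftrightarrow> (\<forall>e\<in>F. \<forall>u v. ends N e = Upair u v \<longrightarrow> (u, v) \<notin> reach N (F - {e}))"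

lemma bridgesD: "bridges N F \<Longrightarrow> e \<in> F \<Longrightarrow> ends N e = Upair u v \<Longrightarrow> (u, v) \<notin> reach N (F - {e})"
  by (auto simp: bridges_def)

lemma bridges_subset:
  assumes "bridges N F" "G \<subseteq> F"
  shows "bridges N G"
  unfolding bridges_def
proof (intro ballI allI impI notI)
  fix e u v assume e: "e \<in> G" "ends N e = Upair u v" "(u, v) \<in> reach N (G - {e})"
  have "(u, v) \<in> reach N (F - {e})" by (rule reach_mono[OF _ e(3)]) (use assms(2) in auto)
  then show False using bridgesD[OF assms(1) _ e(2)] e(1) assms(2) by auto
qed

text \<open>Stepping to a vertex already visited truncates the path there instead of extending it.
  This keeps vertices and edges distinct, as \<open>is_cycle\<close> demands.\<close>

lemma reach_simple_path:
  assumes "(u, v) \<in> reach N G"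
  shows "\<exists>vs es. vs \<noteq> [] \<and> hd vs = u \<and> last vs = v \<and> distinct vs \<and> length vs = Suc (length es)
    \<and> distinct es \<and> set es \<subseteq> G \<and> (\<forall>i<length es. ends N (es ! i) = Upair (vs ! i) (vs ! Suc i))"
  using assms
proof (induction rule: reach_induct)
  case refl
  show ?case by (rule exI[of _ "[u]"], rule exI[of _ "[]"]) simp
next
  case (step y z e)
  then obtain vs es where p: "vs \<noteq> []" "hd vs = u" "last vs = y" "distinct vs"
    "length vs = Suc (length es)" "distinct es" "set es \<subseteq> G"
    "\<And>i. i < length es \<Longrightarrow> ends N (es ! i) = Upair (vs ! i) (vs ! Suc i)" by blast
  show ?case
  proof (cases "z \<in> set vs")
    case True
    then obtain k where k: "k < length vs" "vs ! k = z" by (auto simp: in_set_conv_nth)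
    show ?thesis
    proof (intro exI conjI)
      show "take (Suc k) vs \<noteq> []" "hd (take (Suc k) vs) = u" using p by auto
      show "last (take (Suc k) vs) = z"
        using k by (simp add: take_Suc_conv_app_nth)
      show "distinct (take (Suc k) vs)" "distinct (take k es)" using p by auto
      show "length (take (Suc k) vs) = Suc (length (take k es))" using p k by auto
      show "set (take k es) \<subseteq> G" using p(7) set_take_subset by fastforce
      show "\<forall>i<length (take k es). ends N (take k es ! i)
          = Upair (take (Suc k) vs ! i) (take (Suc k) vs ! Suc i)"
        using p(8) by auto
    qed
  next
    case False
    have "e \<notin> set es"
    proof
      assume "e \<in> set es"
      then obtain i where i: "i < length es" "es ! i = e" by (auto simp: in_set_conv_nth)
      then have "Upair (vs ! i) (vs ! Suc i) = Upair y z" using p(8) step by metis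
      then have "z = vs ! i \<or> z = vs ! Suc i" by auto
      then show False using False i p(5) nth_mem[of i vs] nth_mem[of "Suc i" vs] by auto
    qed
    moreover have "vs ! length es = y" using p(1,3,5) by (simp add: last_conv_nth)
    ultimately show ?thesis using p step False
      by (intro exI[of _ "vs @ [z]"] exI[of _ "es @ [e]"])
        (auto simp: nth_append less_Suc_eq)
  qed
qed

lemma acyclic_iff_bridges: "acyclic_edges N F \<longleftrightarrow> bridges N F"
proof
  assume ac: "acyclic_edges N F"
  show "bridges N F"
    unfolding bridges_def
  proof (intro ballI allI impI notI)
    fix e u v assume e: "e \<in> F" "ends N e = Upair u v" "(u, v) \<in> reach N (F - {e})"
    obtain vs es where p: "vs \<noteq> []" "hd vs = u" "last vs = v" "distinct vs"
      "length vs = Suc (length es)" "distinct es" "set es \<subseteq> F - {e}"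
      "\<And>i. i < length es \<Longrightarrow> ends N (es ! i) = Upair (vs ! i) (vs ! Suc i)"
      using reach_simple_path[OF e(3)] by blast
    have "vs ! length es = v" "vs ! 0 = u" using p(1,2,3,5) by (simp_all add: last_conv_nth hd_conv_nth)
    moreover have "Suc i mod Suc (length es) = Suc i" if "i < length es" for i
      using that by (intro mod_less) simp
    ultimately have "is_cycle N vs (es @ [e])"
      using p e by (auto simp: is_cycle_def nth_append less_Suc_eq)
    moreover have "set (es @ [e]) \<subseteq> F" using p(7) e(1) by auto
    ultimately show False using ac unfolding acyclic_edges_def by blast
  qed
next
  assume br: "bridges N F"
  show "acyclic_edges N F"
    unfolding acyclic_edges_def
  proof (intro notI, elim exE conjE)
    fix vs es assume c: "is_cycle N vs es" and sub: "set es \<subseteq> F"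
    define n where "n = length vs"
    have n: "n > 0" "length es = n" using c by (auto simp: is_cycle_def n_def)
    have en: "ends N (es ! i) = Upair (vs ! i) (vs ! (Suc i mod n))" if "i < n" for i
      using c that by (auto simp: is_cycle_def n_def)
    \<comment> \<open>The walk goes round the cycle avoiding \<open>es ! 0\<close>. Writing
      \<open>1 mod n\<close> lets a loop, where \<open>n = 1\<close>, follow the same
      argument.\<close>
    have "(vs ! (1 mod n), vs ! (Suc j mod n)) \<in> reach N (F - {es ! 0})" if "j < n" for j
      using that
    proof (induction j)
      case (Suc j)
      have "es ! Suc j \<noteq> es ! 0"
        using c Suc.prems n by (auto simp: is_cycle_def nth_eq_iff_index_eq)
      then have "es ! Suc j \<in> F - {es ! 0}" using sub Suc.prems n by auto
      from reach_edge[OF this en[OF Suc.prems]] Suc show ?case by (simp add: reach_comp)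
    qed auto
    from this[of "n - 1"] have "(vs ! (1 mod n), vs ! 0) \<in> reach N (F - {es ! 0})"
      using n by simp
    moreover have "(vs ! 0, vs ! (1 mod n)) \<notin> reach N (F - {es ! 0})"
    proof (rule bridgesD[OF br])
      show "es ! 0 \<in> F" using n sub by auto
      show "ends N (es ! 0) = Upair (vs ! 0) (vs ! (1 mod n))" using en[of 0] n by simp
    qed
    ultimately show False using reach_sym by metis
  qed
qed

lemma spanning_trees_iff:
  "t \<in> spanning_trees N \<longleftrightarrow> t \<subseteq> edges N \<and> connects N t \<and> bridges N t"
  by (simp add: spanning_trees_def acyclic_iff_bridges)

text \<open>An arbitrary direction for each unordered pair. The sign it introduces cancels in
  squares and in products of two quantities attached to the same edge.\<close>

definition orient :: "'v uprod \<Rightarrow> 'v \<times> 'v" where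
  "orient p = inv (case_prod Upair) p"

lemma Upair_orient: "Upair (fst (orient p)) (snd (orient p)) = p"
proof -
  have "surj (case_prod Upair :: 'v \<times> 'v \<Rightarrow> 'v uprod)"
    by (auto simp: surj_def intro: uprod_exhaust)
  then show ?thesis
    unfolding orient_def by (metis case_prod_unfold surj_f_inv_f)
qed

definition edge_diff :: "('v \<Rightarrow> real) \<Rightarrow> 'v uprod \<Rightarrow> real" where
  "edge_diff g p = g (fst (orient p)) - g (snd (orient p))"

lemma edge_diff_Upair_cases:
  "edge_diff g (Upair u v) = g u - g v \<or> edge_diff g (Upair u v) = g v - g u"
  using Upair_orient[of "Upair u v"] by (auto simp: edge_diff_def)

lemma edge_diff_sq [simp]: "(edge_diff g (Upair u v))\<^sup>2 = (g u - g v)\<^sup>2"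
  using edge_diff_Upair_cases[of g u v] by (metis power2_commute)

lemma edge_diff_sq_map: "(edge_diff g (map_uprod \<pi> p))\<^sup>2 = (edge_diff (g \<circ> \<pi>) p)\<^sup>2"
  by (cases p) simp

definition weight :: "('e \<Rightarrow> real) \<Rightarrow> 'e set \<Rightarrow> real" where
  "weight c t = (\<Prod>e\<in>t. c e)"

definition tree_sum :: "('v, 'e) network \<Rightarrow> ('e \<Rightarrow> real) \<Rightarrow> real" where
  "tree_sum N c = (\<Sum>t\<in>spanning_trees N. weight c t)"

definition energy :: "('v, 'e) network \<Rightarrow> ('e \<Rightarrow> real) \<Rightarrow> 'e set \<Rightarrow> ('v \<Rightarrow> real) \<Rightarrow> real" where
  "energy N c S g = (\<Sum>e\<in>S. c e * (edge_diff g (ends N e))\<^sup>2)"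

definition tree_sum_at :: "('v, 'e) network \<Rightarrow> ('e \<Rightarrow> real) \<Rightarrow> 'e \<Rightarrow> real" where
  "tree_sum_at N c e = (\<Sum>t\<in>{t\<in>spanning_trees N. e \<in> t}. weight c t)"

text \<open>The effective conductance between the ends of \<open>e\<close>; by Kirchhoff's formula it is also
  \<open>c e\<close> divided by the probability that the uniform spanning tree contains \<open>e\<close>.\<close>

definition eff_cond :: "('v, 'e) network \<Rightarrow> ('e \<Rightarrow> real) \<Rightarrow> 'e \<Rightarrow> real" where
  "eff_cond N c e = c e * tree_sum N c / tree_sum_at N c e"

text \<open>Indicator of the component of the head of \<open>e\<close> after \<open>e\<close> is
  cut. In a tree, \<open>side N T e y - side N T e x\<close> is the unit flow from \<open>x\<close>
  to \<open>y\<close> along the tree path, evaluated at \<open>e\<close> in the direction chosen by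
  \<open>orient\<close>.\<close>

definition side :: "('v, 'e) network \<Rightarrow> 'e set \<Rightarrow> 'e \<Rightarrow> 'v \<Rightarrow> real" where
  "side N T e z = of_bool ((z, snd (orient (ends N e))) \<in> reach N (T - {e}))"

lemma tree_path_telescope:
  assumes "finite T" "bridges N T" "(x, y) \<in> reach N T"
  shows "(\<Sum>e\<in>T. (side N T e y - side N T e x) * edge_diff g (ends N e)) = g x - g y"
  using assms(3)
proof (induction rule: reach_induct)
  case (step y z f)
  \<comment> \<open>Crossing \<open>f\<close> changes only the side with respect to
    \<open>f\<close>: for any other \<open>e\<close> the ends of \<open>f\<close> remain joined in
    \<open>T - {e}\<close>.\<close>
  have "(\<Sum>e\<in>T. (side N T e z - side N T e y) * edge_diff g (ends N e))
      = (\<Sum>e\<in>T. if e = f then g y - g z else 0)"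
  proof (rule sum.cong)
    fix e assume e: "e \<in> T"
    show "(side N T e z - side N T e y) * edge_diff g (ends N e) = (if e = f then g y - g z else 0)"
    proof (cases "e = f")
      case True
      define l h where "l = fst (orient (ends N f))" and "h = snd (orient (ends N f))"
      have lh: "ends N f = Upair l h" using Upair_orient l_def h_def by metis
      have nr: "(l, h) \<notin> reach N (T - {f})" using bridgesD[OF assms(2) step(2) lh] .
      have d: "edge_diff g (ends N f) = g l - g h" by (simp add: edge_diff_def l_def h_def)
      have "y = l \<and> z = h \<or> y = h \<and> z = l" using lh step by auto
      then show ?thesis using True nr d by (auto simp: side_def h_def[symmetric])
    next
      case False
      then have "(y, z) \<in> reach N (T - {e})" using step by (auto intro: reach_edge)
      then have "side N T e z = side N T e y"
        unfolding side_def by (simp add: reach_comp)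
      then show ?thesis using False by simp
    qed
  qed simp
  also have "\<dots> = g y - g z" using assms(1) step by simp
  finally show ?case using step.IH by (simp add: algebra_simps sum.distrib sum_subtractf)
qed simp

section \<open>Kirchhoff's formula and the Dirichlet principle on a finite network\<close>

locale finite_network =
  fixes N :: "('v, 'e) network"
  assumes finite_edges: "finite (edges N)"
    and connects_edges: "connects N (edges N)"
    and ends_in_verts: "e \<in> edges N \<Longrightarrow> set_uprod (ends N e) \<subseteq> verts N"
begin

lemma finite_spanning_trees: "finite (spanning_trees N)"
  by (rule finite_subset[of _ "Pow (edges N)"]) (auto simp: spanning_trees_def finite_edges)

lemma finite_tree: "t \<in> spanning_trees N \<Longrightarrow> finite t"
  using finite_edges finite_subset by (auto simp: spanning_trees_def)

lemma spanning_tree_exists: "spanning_trees N \<noteq> {}"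
proof -
  define A where "A = {t. t \<subseteq> edges N \<and> connects N t}"
  have "finite A" "edges N \<in> A"
    using finite_edges connects_edges by (auto simp: A_def)
  then obtain t where t: "t \<in> A" "\<And>s. s \<in> A \<Longrightarrow> s \<subseteq> t \<Longrightarrow> s = t"
    using finite_has_minimal2[of A "edges N"] by blast
  have "bridges N t"
    unfolding bridges_def
  proof (intro ballI allI impI notI)
    fix e u v assume e: "e \<in> t" "ends N e = Upair u v" "(u, v) \<in> reach N (t - {e})"
    have "(a, b) \<in> reach N (t - {e})" if "(a, b) \<in> reach N t" for a b
      using reach_insert[of a b N e "t - {e}" u v] that e
      unfolding reach_comp by (auto simp: insert_absorb)
    then have "t - {e} \<in> A" using t(1) by (auto simp: A_def connects_iff)
    then show False using t(2)[of "t - {e}"] e by auto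
  qed
  then show ?thesis using t(1) by (auto simp: A_def spanning_trees_iff)
qed

lemma tree_sum_pos:
  assumes "\<And>e. e \<in> edges N \<Longrightarrow> c e > 0"
  shows "tree_sum N c > 0"
  unfolding tree_sum_def weight_def
  using assms spanning_tree_exists finite_spanning_trees
  by (intro sum_pos prod_pos) (auto simp: spanning_trees_def)

definition forests :: "'v \<Rightarrow> 'v \<Rightarrow> 'e set set" where
  "forests x y = {F. F \<subseteq> edges N \<and> bridges N F \<and> (x, y) \<notin> reach N F
     \<and> (\<forall>z\<in>verts N. (z, x) \<in> reach N F \<or> (z, y) \<in> reach N F)}"

lemma finite_forests: "finite (forests x y)"
  by (rule finite_subset[of _ "Pow (edges N)"]) (auto simp: forests_def finite_edges)

text \<open>Kirchhoff's unnormalised voltage: divided by \<open>tree_sum N c\<close>, it is the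
  voltage at \<open>z\<close> when a unit current runs from \<open>x\<close> to \<open>y\<close> and
  \<open>y\<close> is grounded.\<close>

definition potential :: "('e \<Rightarrow> real) \<Rightarrow> 'v \<Rightarrow> 'v \<Rightarrow> 'v \<Rightarrow> real" where
  "potential c x y z = (\<Sum>F\<in>forests x y. weight c F * of_bool ((z, x) \<in> reach N F))"

text \<open>An edge joining the two components of a forest completes it to a tree. The last
  conclusion says that \<open>e\<close> lies on the tree path from \<open>x\<close> to
  \<open>y\<close>, which is the condition under which \<open>delete_tree_edge\<close> leads
  back.\<close>

lemma insert_forest:
  assumes F: "F \<in> forests x y" and e: "e \<in> edges N" "ends N e = Upair l h"
    and lh: "((l, x) \<in> reach N F) \<noteq> ((h, x) \<in> reach N F)"
    and xy: "x \<in> verts N" "y \<in> verts N"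
  shows "e \<notin> F" "insert e F \<in> spanning_trees N"
    "((x, h) \<in> reach N F) \<noteq> ((y, h) \<in> reach N F)"
proof -
  have v: "l \<in> verts N" "h \<in> verts N" using ends_in_verts[OF e(1)] e(2) by auto
  have F': "F \<subseteq> edges N" "bridges N F" "(x, y) \<notin> reach N F"
    "\<And>z. z \<in> verts N \<Longrightarrow> (z, x) \<in> reach N F \<or> (z, y) \<in> reach N F"
    using F by (auto simp: forests_def)
  have lh_nr: "(l, h) \<notin> reach N F" using lh unfolding reach_comp by metis
  then show "e \<notin> F" using reach_edge[of e F N l h] e by auto
  show xh: "((x, h) \<in> reach N F) \<noteq> ((y, h) \<in> reach N F)"
    using lh F'(3) F'(4)[OF v(2)] unfolding reach_comp by metis
  have "(x, y) \<in> reach N (insert e F)"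
  proof -
    have "(l, h) \<in> reach N (insert e F)" using e by (auto intro: reach_edge)
    moreover have "(l, x) \<in> reach N F \<and> (h, y) \<in> reach N F \<or> (h, x) \<in> reach N F \<and> (l, y) \<in> reach N F"
      using lh F'(4) v by blast
    then have "(l, x) \<in> reach N (insert e F) \<and> (h, y) \<in> reach N (insert e F)
      \<or> (h, x) \<in> reach N (insert e F) \<and> (l, y) \<in> reach N (insert e F)"
      using reach_mono[OF subset_insertI, of _ _ N F e] by blast
    ultimately show ?thesis unfolding reach_comp by metis
  qed
  then have "(z, x) \<in> reach N (insert e F)" if "z \<in> verts N" for z
    using F'(4)[OF that] reach_mono[OF subset_insertI, of z _ N F e] unfolding reach_comp by metis
  then have conn: "connects N (insert e F)"
    by (auto simp: connects_iff reach_comp)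
  have "bridges N (insert e F)"
    unfolding bridges_def
  proof (intro ballI allI impI notI)
    fix f a b assume f: "f \<in> insert e F" "ends N f = Upair a b"
      "(a, b) \<in> reach N (insert e F - {f})"
    show False
    proof (cases "f = e")
      case True
      then have "(a, b) \<in> reach N F" using f(3) \<open>e \<notin> F\<close> by (simp add: insert_absorb)
      moreover have "a = l \<and> b = h \<or> a = h \<and> b = l" using True e f by auto
      ultimately show False using lh_nr reach_sym by metis
    next
      case False
      then have fF: "f \<in> F" using f by auto
      have nr: "(a, b) \<notin> reach N (F - {f})" using bridgesD[OF F'(2) fF f(2)] .
      have "(a, b) \<in> reach N (insert e (F - {f}))" using f False by (simp add: insert_Diff_if)
      from reach_insert[OF this e(2)] nr
      have "(a, l) \<in> reach N F \<and> (h, b) \<in> reach N F \<or> (a, h) \<in> reach N F \<and> (l, b) \<in> reach N F"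
        using reach_mono[OF Diff_subset, of _ _ N F "{f}"] by blast
      moreover have "(a, b) \<in> reach N F" using fF f(2) by (rule reach_edge)
      ultimately show False using lh_nr unfolding reach_comp by metis
    qed
  qed
  then show "insert e F \<in> spanning_trees N"
    using conn e F'(1) by (simp add: spanning_trees_iff)
qed

text \<open>Inverse of the surgery in \<open>insert_forest\<close>: without \<open>e\<close> every
  vertex still hangs on one of the ends of \<open>e\<close>, and the hypothesis places
  \<open>x\<close> and \<open>y\<close> on different ends.\<close>

lemma delete_tree_edge:
  assumes T: "T \<in> spanning_trees N" and e: "e \<in> T" "ends N e = Upair l h"
    and xy: "x \<in> verts N" "y \<in> verts N"
    and d: "((x, h) \<in> reach N (T - {e})) \<noteq> ((y, h) \<in> reach N (T - {e}))"
  shows "T - {e} \<in> forests x y"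
    "((l, x) \<in> reach N (T - {e})) \<noteq> ((h, x) \<in> reach N (T - {e}))"
proof -
  have T': "T \<subseteq> edges N" "connects N T" "bridges N T" using T by (auto simp: spanning_trees_iff)
  have h: "h \<in> verts N" using ends_in_verts[of e] e T' by auto
  have nr: "(l, h) \<notin> reach N (T - {e})" using bridgesD[OF T'(3) e] .
  have lh: "(z, l) \<in> reach N (T - {e}) \<or> (z, h) \<in> reach N (T - {e})" if "z \<in> verts N" for z
  proof -
    have "(z, h) \<in> reach N (insert e (T - {e}))"
      using T'(2) that h e by (auto simp: connects_iff insert_absorb)
    from reach_insert[OF this e(2)] show ?thesis by blast
  qed
  have "(x, y) \<notin> reach N (T - {e})" using d unfolding reach_comp by metis
  moreover have "(z, x) \<in> reach N (T - {e}) \<or> (z, y) \<in> reach N (T - {e})" if "z \<in> verts N" for z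
    using lh[OF that] lh[OF xy(1)] lh[OF xy(2)] d unfolding reach_comp by metis
  ultimately show "T - {e} \<in> forests x y"
    using T' bridges_subset[OF T'(3), of "T - {e}"] by (auto simp: forests_def)
  show "((l, x) \<in> reach N (T - {e})) \<noteq> ((h, x) \<in> reach N (T - {e}))"
    using lh[OF xy(1)] nr unfolding reach_comp by metis
qed

text \<open>The current through \<open>e\<close> is the weighted sum of the tree path flows. Forests
  separating the ends of \<open>e\<close> correspond to trees whose path from \<open>x\<close> to
  \<open>y\<close> uses \<open>e\<close>, by inserting and removing \<open>e\<close>; all other
  terms vanish on both sides.\<close>

lemma potential_gradient:
  assumes e: "e \<in> edges N" and xy: "x \<in> verts N" "y \<in> verts N"
  shows "c e * edge_diff (potential c x y) (ends N e)
    = (\<Sum>T\<in>{T\<in>spanning_trees N. e \<in> T}. weight c T * (side N T e y - side N T e x))"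
proof -
  define l h where "l = fst (orient (ends N e))" and "h = snd (orient (ends N e))"
  have lh: "ends N e = Upair l h" using Upair_orient l_def h_def by metis
  define A where "A = {F\<in>forests x y. ((l, x) \<in> reach N F) \<noteq> ((h, x) \<in> reach N F)}"
  define B where "B = {T\<in>spanning_trees N. e \<in> T
    \<and> ((x, h) \<in> reach N (T - {e})) \<noteq> ((y, h) \<in> reach N (T - {e}))}"
  define a where "a F = weight c F * (of_bool ((l, x) \<in> reach N F) - of_bool ((h, x) \<in> reach N F))"
    for F :: "'e set"
  have "edge_diff (potential c x y) (ends N e) = (\<Sum>F\<in>forests x y. a F)"
    by (simp add: edge_diff_def potential_def a_def l_def h_def sum_subtractf algebra_simps)
  also have "\<dots> = (\<Sum>F\<in>A. a F)"
    by (rule sum.mono_neutral_right) (auto simp: A_def a_def finite_forests)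
  finally have "c e * edge_diff (potential c x y) (ends N e) = (\<Sum>F\<in>A. c e * a F)"
    by (simp add: sum_distrib_left)
  also have "\<dots> = (\<Sum>T\<in>B. weight c T * (side N T e y - side N T e x))"
  proof (rule sum.reindex_bij_witness[where i = "\<lambda>T. T - {e}" and j = "insert e"])
    fix F assume "F \<in> A"
    then have F: "F \<in> forests x y" "((l, x) \<in> reach N F) \<noteq> ((h, x) \<in> reach N F)"
      by (auto simp: A_def)
    note ins = insert_forest[OF F(1) e lh F(2) xy]
    then show "insert e F - {e} = F" "insert e F \<in> B" by (auto simp: B_def)
    have "finite F" using F finite_edges finite_subset by (auto simp: forests_def)
    then have w: "weight c (insert e F) = c e * weight c F" using ins by (simp add: weight_def)
    have "((x, h) \<in> reach N F) = ((h, x) \<in> reach N F)" using reach_sym by metis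
    then show "weight c (insert e F) * (side N (insert e F) e y - side N (insert e F) e x) = c e * a F"
      using ins F(2) by (auto simp: w a_def side_def h_def[symmetric] insert_absorb)
  next
    fix T assume T: "T \<in> B"
    then show "insert e (T - {e}) = T" by (auto simp: B_def)
    show "T - {e} \<in> A" using delete_tree_edge[OF _ _ lh xy, of T] T by (auto simp: A_def B_def)
  qed
  also have "\<dots> = (\<Sum>T\<in>{T\<in>spanning_trees N. e \<in> T}. weight c T * (side N T e y - side N T e x))"
    by (rule sum.mono_neutral_left)
      (auto simp: B_def finite_spanning_trees side_def h_def[symmetric])
  finally show ?thesis .
qed

text \<open>After exchanging the sums, each tree contributes a telescoping sum along its path. Thus
  \<open>potential\<close> represents \<open>g x - g y\<close>, up to the factor
  \<open>tree_sum N c\<close>, in the Dirichlet form, and no Laplace equation has to be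
  solved.\<close>

lemma potential_reproduces:
  assumes xy: "x \<in> verts N" "y \<in> verts N"
  shows "(\<Sum>e\<in>edges N. c e * edge_diff (potential c x y) (ends N e) * edge_diff g (ends N e))
    = tree_sum N c * (g x - g y)"
proof -
  let ?s = "\<lambda>T e. (side N T e y - side N T e x) * edge_diff g (ends N e)"
  have "(\<Sum>e\<in>edges N. c e * edge_diff (potential c x y) (ends N e) * edge_diff g (ends N e))
      = (\<Sum>e\<in>edges N. \<Sum>T\<in>{T\<in>spanning_trees N. e \<in> T}. weight c T * ?s T e)"
    by (rule sum.cong) (auto simp: potential_gradient[OF _ xy] sum_distrib_right mult.assoc)
  also have "\<dots> = (\<Sum>T\<in>spanning_trees N. \<Sum>e\<in>{e\<in>edges N. e \<in> T}. weight c T * ?s T e)"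
    by (rule sum.swap_restrict) (auto simp: finite_edges finite_spanning_trees)
  also have "\<dots> = (\<Sum>T\<in>spanning_trees N. weight c T * (g x - g y))"
  proof (rule sum.cong)
    fix T assume T: "T \<in> spanning_trees N"
    then have "{e\<in>edges N. e \<in> T} = T" by (auto simp: spanning_trees_def)
    moreover have "(\<Sum>e\<in>T. ?s T e) = g x - g y"
      using T xy by (intro tree_path_telescope finite_tree) (auto simp: spanning_trees_iff connects_iff)
    ultimately show "(\<Sum>e\<in>{e\<in>edges N. e \<in> T}. weight c T * ?s T e) = weight c T * (g x - g y)"
      by (simp add: sum_distrib_left[symmetric])
  qed simp
  finally show ?thesis by (simp add: tree_sum_def sum_distrib_right)
qed

text \<open>The reproducing property and Cauchy-Schwarz give the lower bound on the energy; the
  potential rescaled to be 1 at \<open>x\<close> attains it. The range of the minimiser in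
  \<open>[0, 1]\<close> later supplies compactness.\<close>

theorem dirichlet_principle:
  assumes c: "\<And>e. e \<in> edges N \<Longrightarrow> c e > 0" and e: "e \<in> edges N" and nl: "proper_uprod (ends N e)"
  shows "eff_cond N c e > 0" "tree_sum_at N c e > 0"
    "eff_cond N c e * (edge_diff g (ends N e))\<^sup>2 \<le> energy N c (edges N) g"
    "\<exists>g. (\<forall>v. 0 \<le> g v \<and> g v \<le> 1) \<and> (edge_diff g (ends N e))\<^sup>2 = 1 \<and>
      energy N c (edges N) g = eff_cond N c e"
proof -
  define x y where "x = fst (orient (ends N e))" and "y = snd (orient (ends N e))"
  have en: "ends N e = Upair x y" using Upair_orient x_def y_def by metis
  have v: "x \<in> verts N" "y \<in> verts N" using ends_in_verts[OF e] en by auto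
  have ne: "x \<noteq> y" using nl en by simp
  have ed: "edge_diff g (ends N e) = g x - g y" for g by (simp add: edge_diff_def x_def y_def)
  define f where "f = potential c x y"
  define Z where "Z = tree_sum N c"
  have Z: "Z > 0" using tree_sum_pos c by (simp add: Z_def)
  have fy: "f y = 0" unfolding f_def potential_def
    by (rule sum.neutral) (auto simp: forests_def reach_comp)
  have wnn: "weight c F \<ge> 0" if "F \<in> forests x y" for F
    unfolding weight_def using that c by (intro prod_nonneg) (force simp: forests_def)
  have f0: "0 \<le> f z" for z unfolding f_def potential_def by (rule sum_nonneg) (auto simp: wnn)
  have f1: "f z \<le> f x" for z unfolding f_def potential_def by (rule sum_mono) (auto simp: wnn)
  have rep: "(\<Sum>e\<in>edges N. c e * edge_diff f (ends N e) * edge_diff g (ends N e)) = Z * (g x - g y)" for g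
    unfolding f_def Z_def by (rule potential_reproduces[OF v])
  have fE: "energy N c (edges N) f = Z * f x"
    using rep[of f] fy by (simp add: energy_def power2_eq_square mult.assoc)
  have CS: "(Z * (g x - g y))\<^sup>2 \<le> Z * f x * energy N c (edges N) g" for g
  proof -
    have "(\<Sum>e\<in>edges N. c e * edge_diff f (ends N e) * edge_diff g (ends N e))
      = (\<Sum>e\<in>edges N. (sqrt (c e) * edge_diff f (ends N e)) * (sqrt (c e) * edge_diff g (ends N e)))"
      using c by (intro sum.cong) (auto simp: less_imp_le)
    then have "(Z * (g x - g y))\<^sup>2 =
      (\<Sum>e\<in>edges N. (sqrt (c e) * edge_diff f (ends N e)) * (sqrt (c e) * edge_diff g (ends N e)))\<^sup>2"
      using rep[of g] by simp
    also have "\<dots> \<le> (\<Sum>e\<in>edges N. (sqrt (c e) * edge_diff f (ends N e))\<^sup>2)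
        * (\<Sum>e\<in>edges N. (sqrt (c e) * edge_diff g (ends N e))\<^sup>2)"
      by (rule Cauchy_Schwarz_ineq_sum)
    also have "\<dots> = energy N c (edges N) f * energy N c (edges N) g"
      unfolding energy_def using c
      by (intro arg_cong2[of _ _ _ _ "(*)"] sum.cong) (auto simp: power_mult_distrib less_imp_le)
    finally show ?thesis by (simp add: fE)
  qed
  \<comment> \<open>If \<open>f x\<close> vanished, the Cauchy-Schwarz bound applied to the
    indicator of \<open>x\<close> would force \<open>Z\<close> to vanish.\<close>
  have fx: "f x > 0"
  proof (rule ccontr)
    assume "\<not> ?thesis"
    then have "f x = 0" using f0[of x] by simp
    then have "(Z * (of_bool (x = x) - of_bool (y = x)))\<^sup>2 \<le> 0"
      using CS[of "\<lambda>z. of_bool (z = x)"] by simp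
    then show False using Z ne by auto
  qed
  \<comment> \<open>The current through \<open>e\<close> itself: in a tree containing
    \<open>e\<close> the path between the ends of \<open>e\<close> is \<open>e\<close> alone, so
    each such tree contributes its full weight.\<close>
  have at: "tree_sum_at N c e = c e * f x"
  proof -
    have "c e * (f x - f y) = (\<Sum>T\<in>{T\<in>spanning_trees N. e \<in> T}. weight c T * (side N T e y - side N T e x))"
      using potential_gradient[OF e v, of c] by (simp add: f_def ed)
    also have "\<dots> = tree_sum_at N c e"
      unfolding tree_sum_at_def
    proof (rule sum.cong)
      fix T assume T: "T \<in> {T\<in>spanning_trees N. e \<in> T}"
      then have "(x, y) \<notin> reach N (T - {e})" using en by (auto simp: spanning_trees_iff bridges_def)
      then show "weight c T * (side N T e y - side N T e x) = weight c T"
        by (simp add: side_def y_def[symmetric])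
    qed simp
    finally show ?thesis using fy by simp
  qed
  then show "tree_sum_at N c e > 0" using fx c[OF e] by simp
  have C: "eff_cond N c e = Z / f x" using c[OF e] by (simp add: eff_cond_def at Z_def)
  then show "eff_cond N c e > 0" using Z fx by simp
  show "eff_cond N c e * (edge_diff g (ends N e))\<^sup>2 \<le> energy N c (edges N) g"
  proof -
    have "Z * (Z * (g x - g y)\<^sup>2) \<le> Z * (f x * energy N c (edges N) g)"
      using CS[of g] by (simp add: power_mult_distrib power2_eq_square mult_ac)
    then show ?thesis using Z fx by (simp add: C ed field_simps)
  qed
  show "\<exists>g. (\<forall>v. 0 \<le> g v \<and> g v \<le> 1) \<and> (edge_diff g (ends N e))\<^sup>2 = 1 \<and>
      energy N c (edges N) g = eff_cond N c e"
  proof (intro exI conjI allI)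
    let ?g = "\<lambda>z. f z / f x"
    show "0 \<le> ?g v" "?g v \<le> 1" for v using f0 f1 fx by auto
    show "(edge_diff ?g (ends N e))\<^sup>2 = 1" using fx fy by (simp add: ed)
    have "energy N c (edges N) ?g = energy N c (edges N) f / (f x)\<^sup>2"
      by (simp add: energy_def edge_diff_def sum_divide_distrib power_divide diff_divide_distrib[symmetric])
    then show "energy N c (edges N) ?g = eff_cond N c e"
      using fx by (simp add: fE C power2_eq_square)
  qed
qed

lemma tree_sum_at_over_sum:
  assumes "\<And>e. e \<in> edges N \<Longrightarrow> c e > 0" "e \<in> edges N" "proper_uprod (ends N e)"
  shows "tree_sum_at N c e = tree_sum N c * (c e / eff_cond N c e)"
  using dirichlet_principle(1,2)[of c e, OF assms] assms(1)[OF assms(2)] tree_sum_pos[of c, OF assms(1)]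
  by (simp add: eff_cond_def)

end

subsection \<open>Doubling conductances\<close>

definition double :: "'e set \<Rightarrow> ('e \<Rightarrow> real) \<Rightarrow> 'e \<Rightarrow> real" where
  "double S c e = (if e \<in> S then 2 else 1) * c e"

lemma double_empty [simp]: "double {} c = c"
  by (auto simp: double_def)

lemma weight_double: "finite t \<Longrightarrow> weight (double S c) t = 2 ^ card (t \<inter> S) * weight c t"
  by (simp add: weight_def double_def prod.distrib prod.If_cases)

context finite_network
begin

lemma tree_sum_double_insert:
  assumes "e \<notin> S"
  shows "tree_sum N (double (insert e S) c) = tree_sum N (double S c) + tree_sum_at N (double S c) e"
proof -
  have w: "weight (double (insert e S) c) t = weight (double S c) t + (if e \<in> t then weight (double S c) t else 0)"
    if "t \<in> spanning_trees N" for t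
  proof (cases "e \<in> t")
    case True
    have "t \<inter> insert e S = insert e (t \<inter> S)" using True by auto
    then have "card (t \<inter> insert e S) = Suc (card (t \<inter> S))"
      using assms finite_tree[OF that] by simp
    then show ?thesis using True finite_tree[OF that] by (simp add: weight_double)
  next
    case False
    then have "t \<inter> insert e S = t \<inter> S" by auto
    then show ?thesis using False finite_tree[OF that] by (simp add: weight_double)
  qed
  show ?thesis
    unfolding tree_sum_def tree_sum_at_def
    using finite_spanning_trees
    by (simp add: w sum.distrib sum.inter_filter)
qed

text \<open>Doubling \<open>e\<close> adds exactly the weight of the trees through \<open>e\<close>.
  The new factor is one plus the probability of \<open>e\<close> for the conductances already
  doubled on \<open>S\<close>.\<close>

lemma tree_sum_double_step:
  assumes "\<And>e. e \<in> edges N \<Longrightarrow> c e > 0" "e \<in> edges N" "proper_uprod (ends N e)" "e \<notin> S"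
  shows "tree_sum N (double (insert e S) c) / tree_sum N c
    = tree_sum N (double S c) / tree_sum N c * (1 + double S c e / eff_cond N (double S c) e)"
proof -
  have "tree_sum_at N (double S c) e = tree_sum N (double S c) * (double S c e / eff_cond N (double S c) e)"
    using assms by (intro tree_sum_at_over_sum) (auto simp: double_def)
  then show ?thesis by (simp add: tree_sum_double_insert[OF assms(4)] algebra_simps add_divide_distrib)
qed

text \<open>Test sets range over the whole edge type, so they may contain elements that are not
  edges of the network.\<close>

lemma tree_sum_double_outside:
  assumes "e \<notin> edges N" "e \<notin> S"
  shows "tree_sum N (double (insert e S) c) = tree_sum N (double S c)"
proof -
  have "{t \<in> spanning_trees N. e \<in> t} = {}" using assms by (auto simp: spanning_trees_def)
  then show ?thesis by (simp only: tree_sum_double_insert[OF assms(2)] tree_sum_at_def) simp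
qed

lemma UST_expectation:
  assumes c: "\<And>e. e \<in> edges N \<Longrightarrow> cond N e > 0"
  shows "measure_pmf.expectation (UST N) F
    = (\<Sum>t\<in>spanning_trees N. F t * weight (cond N) t) / tree_sum N (cond N)"
proof -
  define p where "p t = (if t \<in> spanning_trees N then tree_weight N t / (\<Sum>s\<in>spanning_trees N. tree_weight N s) else 0)" for t
  have tw: "tree_weight N t = weight (cond N) t" for t by (simp add: tree_weight_def weight_def)
  have w: "weight (cond N) t \<ge> 0" if "t \<in> spanning_trees N" for t
    unfolding weight_def using that c by (intro prod_nonneg) (force simp: spanning_trees_def)
  have Z: "tree_sum N (cond N) > 0" using tree_sum_pos c by blast
  have nn: "p t \<ge> 0" for t
    using w Z by (auto simp: p_def tw tree_sum_def[symmetric])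
  have "(\<integral>\<^sup>+ t. ennreal (p t) \<partial>count_space UNIV) = (\<Sum>t\<in>spanning_trees N. ennreal (p t))"
    by (subst nn_integral_count_space'[of "spanning_trees N"])
      (auto simp: finite_spanning_trees p_def)
  also have "\<dots> = ennreal (\<Sum>t\<in>spanning_trees N. p t)" by (rule sum_ennreal) (rule nn)
  also have "(\<Sum>t\<in>spanning_trees N. p t) = 1"
    using Z by (simp add: p_def tw sum_divide_distrib[symmetric] tree_sum_def[symmetric])
  finally have "(\<integral>\<^sup>+ t. ennreal (p t) \<partial>count_space UNIV) = 1" by simp
  then have pm: "pmf (UST N) t = p t" for t
    using nn pmf_embed_pmf[of p t] by (simp add: UST_def p_def[abs_def])
  have "measure_pmf.expectation (UST N) F = (\<Sum>t\<in>spanning_trees N. F t * pmf (UST N) t)"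
    by (rule integral_measure_pmf_real) (auto simp: finite_spanning_trees set_pmf_eq pm p_def split: if_splits)
  also have "\<dots> = (\<Sum>t\<in>spanning_trees N. F t * weight (cond N) t) / tree_sum N (cond N)"
    by (simp add: pm p_def tw tree_sum_def sum_divide_distrib)
  finally show ?thesis .
qed

lemma UST_expectation_power:
  assumes "\<And>e. e \<in> edges N \<Longrightarrow> cond N e > 0"
  shows "measure_pmf.expectation (UST N) (\<lambda>t. 2 ^ card (t \<inter> S))
    = tree_sum N (double S (cond N)) / tree_sum N (cond N)"
  unfolding UST_expectation[of "\<lambda>t. 2 ^ card (t \<inter> S)", OF assms, simplified] unfolding tree_sum_def
  by (intro arg_cong2[of _ _ _ _ "(/)"] sum.cong) (auto simp: weight_double finite_tree)

end

subsection \<open>Effective conductances along an exhaustion\<close>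

text \<open>Tychonoff for the cube. Countability of the vertex type makes the product metrisable, so
  that compactness yields subsequences.\<close>

lemma pointwise_convergent_subsequence:
  fixes f :: "nat \<Rightarrow> 'v :: countable \<Rightarrow> real"
  assumes "\<And>n v. 0 \<le> f n v \<and> f n v \<le> 1"
  obtains r l where "strict_mono (r :: nat \<Rightarrow> nat)" "\<And>v. (\<lambda>n. f (r n) v) \<longlonglongrightarrow> l v"
    "\<And>v. 0 \<le> l v \<and> l v \<le> 1"
proof -
  have "compactin (product_topology (\<lambda>_. euclidean) UNIV) (PiE UNIV (\<lambda>_ :: 'v. {0..1 :: real}))"
    by (simp add: compactin_PiE)
  then have "compact (PiE UNIV (\<lambda>_ :: 'v. {0..1 :: real}))"
    by (simp add: euclidean_product_topology)
  then have "seq_compact (PiE UNIV (\<lambda>_ :: 'v. {0..1 :: real}))"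
    by (simp add: compact_eq_seq_compact_metric)
  moreover have "\<forall>n. f n \<in> PiE UNIV (\<lambda>_ :: 'v. {0..1 :: real})" using assms by auto
  ultimately obtain l r where l: "l \<in> PiE UNIV (\<lambda>_ :: 'v. {0..1 :: real})" "strict_mono (r :: nat \<Rightarrow> nat)"
    "(f \<circ> r) \<longlonglongrightarrow> l" by (rule seq_compactE)
  have "(\<lambda>n. f (r n) v) \<longlonglongrightarrow> l v" for v
    using continuous_on_tendsto_compose[OF continuous_on_product_coordinates[of v] l(3)]
    by (simp add: o_def)
  then show ?thesis using that l by (force simp: PiE_iff)
qed

text \<open>A bound on a possibly infinite Dirichlet sum through its finite parts: summability never
  has to be discussed, and the bound survives pointwise limits.\<close>

definition energy_le :: "('v, 'e) network \<Rightarrow> ('e \<Rightarrow> real) \<Rightarrow> ('v \<Rightarrow> real) \<Rightarrow> real \<Rightarrow> bool" where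
  "energy_le N c g K \<longleftrightarrow> (\<forall>S. finite S \<and> S \<subseteq> edges N \<longrightarrow> energy N c S g \<le> K)"

text \<open>The free effective conductance between the ends of \<open>e\<close> in the infinite
  network, as an infimum over energy bounds. The range \<open>[0, 1]\<close> matches that of the
  minimisers in \<open>dirichlet_principle\<close>.\<close>

definition limit_cond :: "('v, 'e) network \<Rightarrow> ('e \<Rightarrow> real) \<Rightarrow> 'e \<Rightarrow> real" where
  "limit_cond N c e =
    Inf {K. \<exists>g. (\<forall>v. 0 \<le> g v \<and> g v \<le> 1) \<and> (edge_diff g (ends N e))\<^sup>2 = 1 \<and> energy_le N c g K}"

lemma energy_mono:
  assumes "finite B" "A \<subseteq> B" "\<And>e. e \<in> B \<Longrightarrow> c e \<ge> 0"
  shows "energy N c A g \<le> energy N c B g"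
  unfolding energy_def using assms by (intro sum_mono2) auto

text \<open>The assumption \<open>approx\<close> says that finitely supported functions, up to constants, are dense
  among the functions of finite Dirichlet energy, for every network of comparable conductances.\<close>

locale approximable_network =
  fixes N :: "('v :: countable, 'e :: countable) network"
  assumes verts_UNIV: "verts N = UNIV"
    and locally_finite: "finite {e \<in> edges N. v \<in> set_uprod (ends N e)}"
    and cond_pos: "e \<in> edges N \<Longrightarrow> cond N e > 0"
    and no_loops: "e \<in> edges N \<Longrightarrow> proper_uprod (ends N e)"
    and exhaustion_exists: "\<exists>V. exhaustion N V"
    and approx: "\<lbrakk>\<And>e. e \<in> edges N \<Longrightarrow> cond N e \<le> c e \<and> c e \<le> 2 * cond N e;
      energy_le N c g K; finite A; \<epsilon> > 0\<rbrakk> \<Longrightarrow>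
      \<exists>g' W k. finite W \<and> (\<forall>v\<in>A. g' v = g v) \<and> (\<forall>v. v \<notin> W \<longrightarrow> g' v = k) \<and> energy_le N c g' (K + \<epsilon>)"
begin

lemma finite_edges_at: "finite V \<Longrightarrow> finite {e \<in> edges N. set_uprod (ends N e) \<inter> V \<noteq> {}}"
  by (rule finite_subset[of _ "\<Union>v\<in>V. {e \<in> edges N. v \<in> set_uprod (ends N e)}"])
    (auto intro: locally_finite)

lemma finite_edges_within:
  assumes "finite V"
  shows "finite {e \<in> edges N. set_uprod (ends N e) \<subseteq> V}"
proof (rule finite_subset[OF _ finite_edges_at[OF assms]])
  have "set_uprod p \<noteq> {}" for p :: "'v uprod" by (cases p) auto
  then show "{e \<in> edges N. set_uprod (ends N e) \<subseteq> V} \<subseteq> {e \<in> edges N. set_uprod (ends N e) \<inter> V \<noteq> {}}"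
    by blast
qed

lemma finite_ext_boundary:
  assumes "finite V"
  shows "finite (ext_boundary N V)"
proof (rule finite_subset)
  show "ext_boundary N V \<subseteq> (\<Union>e\<in>{e \<in> edges N. set_uprod (ends N e) \<inter> V \<noteq> {}}. set_uprod (ends N e))"
    by (fastforce simp: ext_boundary_def)
qed (use finite_edges_at[OF assms] in auto)

lemma finite_network_induced:
  assumes "finite V" "connected_network (induced N V)"
  shows "finite_network (induced N V)"
  using assms finite_edges_within[OF assms(1)]
  by unfold_locales (auto simp: connected_network_def induced_def)

abbreviation proj :: "'v set \<Rightarrow> 'v \<Rightarrow> 'v option" where
  "proj V v \<equiv> (if v \<in> V then Some v else None)"

lemma wired_simps:
  "verts (wired N V) = proj V ` (V \<union> ext_boundary N V)"
  "edges (wired N V) = {e \<in> edges N. set_uprod (ends N e) \<subseteq> V \<union> ext_boundary N V}"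
  "ends (wired N V) = (\<lambda>e. map_uprod (proj V) (ends N e))"
  "cond (wired N V) = cond N"
  by (simp_all add: wired_def map_verts_def induced_def)

text \<open>Paths inside \<open>V\<close> survive the projection, and every boundary vertex is
  joined to \<open>V\<close> by an edge, so wiring keeps the network connected.\<close>

lemma finite_network_wired:
  assumes "finite V" "connected_network (induced N V)"
  shows "finite_network (wired N V)"
proof
  show "finite (edges (wired N V))"
    unfolding wired_simps using assms finite_ext_boundary finite_edges_within by blast
  show "set_uprod (ends (wired N V) e) \<subseteq> verts (wired N V)" if "e \<in> edges (wired N V)" for e
  proof (cases "ends N e")
    case (Upair a b)
    then show ?thesis using that by (auto simp: wired_simps)
  qed
  let ?E = "edges (wired N V)"
  obtain v0 where v0: "v0 \<in> V" using assms(2) by (auto simp: connected_network_def induced_def)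
  have inner: "(Some a, Some b) \<in> reach (wired N V) ?E" if ab: "a \<in> V" "b \<in> V" for a b
  proof -
    have "(a, b) \<in> reach (induced N V) (edges (induced N V))"
      using assms(2) ab by (auto simp: connected_network_def connects_iff induced_def)
    then have "(proj V a, proj V b) \<in> reach (wired N V) ?E"
    proof (induction rule: reach_induct)
      case (step y z e)
      then have "e \<in> ?E" "ends (wired N V) e = Upair (proj V y) (proj V z)"
        by (auto simp: induced_def wired_simps)
      then have "(proj V y, proj V z) \<in> reach (wired N V) ?E" by (rule reach_edge)
      then show ?case using step.IH by (metis reach_trans)
    qed simp
    then show ?thesis using ab by simp
  qed
  have "(proj V y, Some v0) \<in> reach (wired N V) ?E" if y: "y \<in> V \<union> ext_boundary N V" for y
  proof (cases "y \<in> V")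
    case True
    then show ?thesis using inner v0 by simp
  next
    case False
    then obtain x e where e: "x \<in> V" "e \<in> edges N" "ends N e = Upair x y"
      using y by (auto simp: ext_boundary_def)
    then have "e \<in> ?E" "ends (wired N V) e = Upair (Some x) (proj V y)"
      using y False by (auto simp: wired_simps)
    then have "(Some x, proj V y) \<in> reach (wired N V) ?E" by (rule reach_edge)
    then show ?thesis using inner[OF e(1) v0] by (metis reach_trans reach_sym)
  qed
  then have "(x, Some v0) \<in> reach (wired N V) ?E" if "x \<in> verts (wired N V)" for x
    using that unfolding wired_simps(1) by blast
  then show "connects (wired N V) ?E"
    unfolding connects_iff by (blast intro: reach_trans reach_sym)
qed

lemma energy_wired: "energy (wired N V) c S g = energy N c S (g \<circ> proj V)"
  unfolding energy_def wired_simps edge_diff_sq_map ..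

text \<open>Pulling a function back from the wired network creates no energy: an edge of
  \<open>N\<close> missing there has both ends outside \<open>V\<close>, where the pull-back is
  constantly \<open>g None\<close>.\<close>

lemma energy_le_proj:
  assumes "finite V" and c: "\<And>e. e \<in> edges N \<Longrightarrow> c e \<ge> 0"
  shows "energy_le N c (g \<circ> proj V) (energy (wired N V) c (edges (wired N V)) g)"
  unfolding energy_le_def
proof (intro allI impI, elim conjE)
  fix S assume S: "finite S" "S \<subseteq> edges N"
  let ?E = "edges (wired N V)"
  have fin: "finite ?E"
    unfolding wired_simps using assms finite_ext_boundary finite_edges_within by blast
  have "edge_diff (g \<circ> proj V) (ends N e) = 0" if e: "e \<in> edges N" "e \<notin> ?E" for e
  proof -
    have outside: "x \<notin> V" if "ends N e = Upair x y" for x y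
    proof
      assume "x \<in> V"
      then have "y \<in> V \<union> ext_boundary N V"
        using e(1) that unfolding ext_boundary_def verts_UNIV by blast
      then show False using e that \<open>x \<in> V\<close> by (simp add: wired_simps)
    qed
    obtain a b where ab: "ends N e = Upair a b" by (meson uprod_exhaust)
    have "a \<notin> V" "b \<notin> V"
      using outside[OF ab] outside[of b a] ab by auto
    then have "(edge_diff (g \<circ> proj V) (ends N e))\<^sup>2 = 0" unfolding ab by simp
    then show ?thesis by simp
  qed
  then have "energy N c S (g \<circ> proj V) = energy N c (S \<inter> ?E) (g \<circ> proj V)"
    unfolding energy_def using S by (intro sum.mono_neutral_right) auto
  also have "\<dots> \<le> energy N c ?E (g \<circ> proj V)"
    using fin c by (intro energy_mono) (auto simp: wired_simps)
  finally show "energy N c S (g \<circ> proj V) \<le> energy (wired N V) c ?E g" by (simp add: energy_wired)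
qed

lemma eventually_subset:
  assumes "exhaustion N V" "finite W"
  shows "\<forall>\<^sub>F q in sequentially. W \<subseteq> V q"
proof -
  have "\<forall>\<^sub>F q in sequentially. w \<in> V q" for w
  proof -
    have "w \<in> (\<Union>q. V q)" using assms(1) by (simp add: exhaustion_def verts_UNIV)
    then obtain q where "w \<in> V q" by auto
    moreover have "incseq V" using assms(1) by (simp add: exhaustion_def)
    ultimately show ?thesis by (auto simp: eventually_sequentially incseq_def)
  qed
  then have "\<forall>\<^sub>F q in sequentially. \<forall>w\<in>W. w \<in> V q" using assms(2) by (simp add: eventually_ball_finite)
  then show ?thesis by (simp add: subset_iff Ball_def)
qed

section \<open>Wired and free effective conductances for fixed comparable conductances\<close>

context
  fixes c :: "'e \<Rightarrow> real" and e :: 'e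
  assumes comparable: "\<And>e. e \<in> edges N \<Longrightarrow> cond N e \<le> c e \<and> c e \<le> 2 * cond N e"
    and edge: "e \<in> edges N"
begin

abbreviation competitor :: "('v \<Rightarrow> real) \<Rightarrow> real \<Rightarrow> bool" where
  "competitor g K \<equiv>
    (\<forall>v. 0 \<le> g v \<and> g v \<le> 1) \<and> (edge_diff g (ends N e))\<^sup>2 = 1 \<and> energy_le N c g K"

lemma c_pos: "e' \<in> edges N \<Longrightarrow> c e' > 0"
  using comparable[of e'] cond_pos[of e'] by simp

text \<open>The edge \<open>e\<close> alone already costs \<open>c e\<close>. This bounds the
  infimum in \<open>limit_cond\<close> from below and makes it positive.\<close>

lemma competitor_ge: "competitor g K \<Longrightarrow> c e \<le> K"
  using edge by (auto simp: energy_le_def energy_def dest!: spec[of _ "{e}"])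

lemma limit_cond_le: "competitor g K \<Longrightarrow> limit_cond N c e \<le> K"
proof -
  have "bdd_below {K. \<exists>g. competitor g K}"
  proof (rule bdd_belowI)
    fix K assume "K \<in> {K. \<exists>g. competitor g K}"
    then show "c e \<le> K" using competitor_ge by blast
  qed
  then show "competitor g K \<Longrightarrow> limit_cond N c e \<le> K"
    unfolding limit_cond_def by (rule cInf_lower[rotated]) blast
qed

text \<open>The pulled-back wired minimiser shows that wired conductances never fall below
  \<open>limit_cond\<close>. The second conclusion serves the opposite estimate, for functions that
  factor through the wiring.\<close>

lemma wired_competitor:
  assumes V: "finite V" "connected_network (induced N V)" and e: "set_uprod (ends N e) \<subseteq> V"
  shows "\<exists>g. competitor g (eff_cond (wired N V) c e)"
    "eff_cond (wired N V) c e * (edge_diff (g \<circ> proj V) (ends N e))\<^sup>2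
      \<le> energy N c (edges (wired N V)) (g \<circ> proj V)"
    "proper_uprod (ends (wired N V) e)" "e \<in> edges (wired N V)"
proof -
  interpret W: finite_network "wired N V" by (rule finite_network_wired[OF V])
  have pos: "e' \<in> edges (wired N V) \<Longrightarrow> c e' > 0" for e' using c_pos by (auto simp: wired_simps)
  show eW: "e \<in> edges (wired N V)" using edge e by (auto simp: wired_simps)
  show pr: "proper_uprod (ends (wired N V) e)"
    using no_loops[OF edge] e by (cases "ends N e") (auto simp: wired_simps)
  show "eff_cond (wired N V) c e * (edge_diff (g \<circ> proj V) (ends N e))\<^sup>2
      \<le> energy N c (edges (wired N V)) (g \<circ> proj V)"
    using W.dirichlet_principle(3)[of c e g, OF pos eW pr]
    by (simp only: energy_wired wired_simps(3) edge_diff_sq_map)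
  obtain g where g: "\<And>v. 0 \<le> g v \<and> g v \<le> 1" "(edge_diff g (ends (wired N V) e))\<^sup>2 = 1"
    "energy (wired N V) c (edges (wired N V)) g = eff_cond (wired N V) c e"
    using W.dirichlet_principle(4)[of c e, OF pos eW pr] by blast
  have "energy_le N c (g \<circ> proj V) (eff_cond (wired N V) c e)"
    using energy_le_proj[OF V(1), of c g] c_pos g(3) by (auto simp: less_imp_le)
  then have "competitor (g \<circ> proj V) (eff_cond (wired N V) c e)"
    using g(1,2) by (simp only: wired_simps(3) edge_diff_sq_map) simp
  then show "\<exists>g. competitor g (eff_cond (wired N V) c e)" by blast
qed

lemma competitor_exists: "\<exists>g K. competitor g K"
proof -
  obtain V where V: "exhaustion N V" using exhaustion_exists by blast
  obtain q where "set_uprod (ends N e) \<subseteq> V q"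
    using eventually_happens[OF eventually_subset[OF V finite_set_uprod]] by auto
  then show ?thesis using wired_competitor(1) V by (meson exhaustion_def)
qed

lemma limit_cond_pos: "limit_cond N c e > 0"
proof -
  have "c e \<le> limit_cond N c e" unfolding limit_cond_def
    using competitor_exists competitor_ge by (intro cInf_greatest) blast+
  then show ?thesis using c_pos[OF edge] by simp
qed

text \<open>For the upper bound a near-optimal competitor is made constant off a finite set
  \<open>W\<close> by \<open>approx\<close>, with its values at the ends of \<open>e\<close>
  unchanged. Once \<open>W\<close> lies in \<open>V q\<close>, the result is a function on the wired
  network, with value \<open>k\<close> at \<open>None\<close>.\<close>

lemma wired_eff_cond_tendsto:
  assumes V: "exhaustion N V"
  shows "(\<lambda>q. eff_cond (wired N (V q)) c e) \<longlonglongrightarrow> limit_cond N c e"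
proof (rule order_tendstoI)
  have fV: "finite (V q)" "connected_network (induced N (V q))" for q
    using V by (auto simp: exhaustion_def)
  have ev: "\<forall>\<^sub>F q in sequentially. set_uprod (ends N e) \<subseteq> V q" by (rule eventually_subset[OF V]) simp
  show "\<forall>\<^sub>F q in sequentially. a < eff_cond (wired N (V q)) c e" if "a < limit_cond N c e" for a
    using ev
  proof eventually_elim
    case (elim q)
    obtain g where "competitor g (eff_cond (wired N (V q)) c e)"
      using wired_competitor(1)[OF fV elim] by blast
    then show ?case using limit_cond_le that by (blast intro: less_le_trans)
  qed
  fix a assume "limit_cond N c e < a"
  moreover have "{K. \<exists>g. competitor g K} \<noteq> {}" using competitor_exists by blast
  ultimately obtain K g where K: "K < a" "competitor g K"
    using cInf_lessD[of "{K. \<exists>g. competitor g K}" a] unfolding limit_cond_def by auto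
  define \<epsilon> where "\<epsilon> = (a - K) / 2"
  have eps: "\<epsilon> > 0" using K by (simp add: \<epsilon>_def)
  obtain g' W k where g': "finite W" "\<And>v. v \<in> set_uprod (ends N e) \<Longrightarrow> g' v = g v"
    "\<And>v. v \<notin> W \<Longrightarrow> g' v = k" "energy_le N c g' (K + \<epsilon>)"
    using approx[of c g K "set_uprod (ends N e)" \<epsilon>, OF comparable _ finite_set_uprod eps] K(2) by metis
  have d: "(edge_diff g' (ends N e))\<^sup>2 = 1"
    using K(2) g'(2) by (cases "ends N e") auto
  show "\<forall>\<^sub>F q in sequentially. eff_cond (wired N (V q)) c e < a"
    using ev eventually_subset[OF V g'(1)]
  proof eventually_elim
    case (elim q)
    define h where "h v = (case v of None \<Rightarrow> k | Some v \<Rightarrow> g' v)" for v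
    have h: "h \<circ> proj (V q) = g'" using g'(3) elim(2) by (auto simp: h_def fun_eq_iff)
    have "eff_cond (wired N (V q)) c e \<le> energy N c (edges (wired N (V q))) g'"
      using wired_competitor(2)[OF fV elim(1), of h] unfolding h d by simp
    also have "\<dots> \<le> K + \<epsilon>"
    proof -
      interpret W: finite_network "wired N (V q)" by (rule finite_network_wired[OF fV])
      show ?thesis using g'(4) W.finite_edges by (auto simp: energy_le_def wired_simps)
    qed
    also have "\<dots> < a" using K by (simp add: \<epsilon>_def field_simps)
    finally show ?case .
  qed
qed

text \<open>Keeping only the edges inside \<open>V\<close> can only lose energy, so free
  conductances stay below \<open>limit_cond\<close>.\<close>

lemma induced_competitor:
  assumes V: "finite V" "connected_network (induced N V)" and e: "set_uprod (ends N e) \<subseteq> V"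
  shows "eff_cond (induced N V) c e \<le> limit_cond N c e"
    "\<exists>g. (\<forall>v. 0 \<le> g v \<and> g v \<le> 1) \<and> (edge_diff g (ends N e))\<^sup>2 = 1 \<and>
      energy N c (edges (induced N V)) g = eff_cond (induced N V) c e"
    "e \<in> edges (induced N V)" "proper_uprod (ends (induced N V) e)"
proof -
  interpret I: finite_network "induced N V" by (rule finite_network_induced[OF V])
  have pos: "e' \<in> edges (induced N V) \<Longrightarrow> c e' > 0" for e' using c_pos by (auto simp: induced_def)
  show eI: "e \<in> edges (induced N V)" using edge e by (auto simp: induced_def)
  show pr: "proper_uprod (ends (induced N V) e)" using no_loops[OF edge] by (simp add: induced_def)
  have en: "energy (induced N V) c S g = energy N c S g" for S g
    by (simp add: energy_def induced_def)
  show "\<exists>g. (\<forall>v. 0 \<le> g v \<and> g v \<le> 1) \<and> (edge_diff g (ends N e))\<^sup>2 = 1 \<and>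
      energy N c (edges (induced N V)) g = eff_cond (induced N V) c e"
    using I.dirichlet_principle(4)[of c e, OF pos eI pr] unfolding en by (simp add: induced_def)
  have "eff_cond (induced N V) c e \<le> K" if "competitor g K" for g K
  proof -
    have "eff_cond (induced N V) c e \<le> energy N c (edges (induced N V)) g"
      using I.dirichlet_principle(3)[of c e g, OF pos eI pr] that unfolding en by (simp add: induced_def)
    also have "\<dots> \<le> K" using that I.finite_edges by (auto simp: energy_le_def induced_def)
    finally show ?thesis .
  qed
  then show "eff_cond (induced N V) c e \<le> limit_cond N c e"
    unfolding limit_cond_def using competitor_exists by (intro cInf_greatest) blast+
qed

text \<open>If free conductances were at most \<open>a\<close> infinitely often, their
  \<open>[0, 1]\<close>-valued minimisers would have a pointwise limit along a subsequence. Each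
  finite set of edges eventually lies in the induced networks, so this limit is a competitor of
  energy at most \<open>a\<close>, below the infimum.\<close>

lemma induced_eff_cond_tendsto:
  assumes V: "exhaustion N V"
  shows "(\<lambda>q. eff_cond (induced N (V q)) c e) \<longlonglongrightarrow> limit_cond N c e"
proof (rule order_tendstoI)
  have fV: "finite (V q)" "connected_network (induced N (V q))" for q
    using V by (auto simp: exhaustion_def)
  have ev: "\<forall>\<^sub>F q in sequentially. set_uprod (ends N e) \<subseteq> V q" by (rule eventually_subset[OF V]) simp
  show "\<forall>\<^sub>F q in sequentially. eff_cond (induced N (V q)) c e < a" if "limit_cond N c e < a" for a
    using ev
  proof eventually_elim
    case (elim q)
    then show ?case using induced_competitor(1)[OF fV elim] that by simp
  qed
  fix a assume a: "a < limit_cond N c e"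
  show "\<forall>\<^sub>F q in sequentially. a < eff_cond (induced N (V q)) c e"
  proof (rule ccontr)
    assume "\<not> ?thesis"
    then have "\<exists>\<^sub>F q in sequentially. eff_cond (induced N (V q)) c e \<le> a"
      by (simp add: not_eventually not_less)
    then have "\<exists>\<^sub>F q in sequentially. eff_cond (induced N (V q)) c e \<le> a \<and> set_uprod (ends N e) \<subseteq> V q"
      using ev by (rule frequently_eventually_frequently)
    then have inf: "infinite {q. eff_cond (induced N (V q)) c e \<le> a \<and> set_uprod (ends N e) \<subseteq> V q}"
      by (simp add: frequently_cofinite[symmetric] cofinite_eq_sequentially)
    define s where "s = enumerate {q. eff_cond (induced N (V q)) c e \<le> a \<and> set_uprod (ends N e) \<subseteq> V q}"
    have s: "strict_mono s" unfolding s_def using inf by (rule strict_mono_enumerate)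
    have sa: "eff_cond (induced N (V (s n))) c e \<le> a" "set_uprod (ends N e) \<subseteq> V (s n)" for n
      using enumerate_in_set[OF inf, of n] by (auto simp: s_def)
    have "\<exists>f. \<forall>n. (\<forall>v. 0 \<le> f n v \<and> f n v \<le> 1) \<and> (edge_diff (f n) (ends N e))\<^sup>2 = 1 \<and>
      energy N c (edges (induced N (V (s n)))) (f n) \<le> a"
    proof (rule choice, rule allI)
      fix n
      show "\<exists>g. (\<forall>v. 0 \<le> g v \<and> g v \<le> 1) \<and> (edge_diff g (ends N e))\<^sup>2 = 1 \<and>
        energy N c (edges (induced N (V (s n)))) g \<le> a"
        using induced_competitor(2)[OF fV sa(2)[of n]] sa(1)[of n] by auto
    qed
    then obtain f where f: "\<And>n v. 0 \<le> f n v \<and> f n v \<le> 1" "\<And>n. (edge_diff (f n) (ends N e))\<^sup>2 = 1"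
      "\<And>n. energy N c (edges (induced N (V (s n)))) (f n) \<le> a" by blast
    obtain r l where r: "strict_mono (r :: nat \<Rightarrow> nat)" and l: "\<And>v. (\<lambda>n. f (r n) v) \<longlonglongrightarrow> l v"
      "\<And>v. 0 \<le> l v \<and> l v \<le> 1"
      by (rule pointwise_convergent_subsequence[of f, OF f(1)]) (rule that)
    have dl: "(\<lambda>n. (edge_diff (f (r n)) p)\<^sup>2) \<longlonglongrightarrow> (edge_diff l p)\<^sup>2" for p
      unfolding edge_diff_def by (intro tendsto_power tendsto_diff l)
    have "(edge_diff l (ends N e))\<^sup>2 = 1"
      using LIMSEQ_unique[OF dl[of "ends N e"]] f(2) by simp
    moreover have "energy_le N c l a"
      unfolding energy_le_def
    proof (intro allI impI, elim conjE)
      fix S assume S: "finite S" "S \<subseteq> edges N"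
      have lim: "(\<lambda>n. energy N c S (f (r n))) \<longlonglongrightarrow> energy N c S l"
        unfolding energy_def by (intro tendsto_sum tendsto_mult[OF tendsto_const] dl)
      have "strict_mono (\<lambda>n. s (r n))" using s r by (simp add: strict_mono_def)
      then have "\<forall>\<^sub>F n in sequentially. (\<Union>e\<in>S. set_uprod (ends N e)) \<subseteq> V (s (r n))"
        using S by (intro eventually_subseq[of "\<lambda>n. s (r n)"] eventually_subset[OF V]) auto
      then have "\<forall>\<^sub>F n in sequentially. energy N c S (f (r n)) \<le> a"
      proof eventually_elim
        case (elim n)
        interpret I: finite_network "induced N (V (s (r n)))" by (rule finite_network_induced[OF fV])
        have "S \<subseteq> edges (induced N (V (s (r n))))" using elim S by (auto simp: induced_def)
        then have "energy N c S (f (r n)) \<le> energy N c (edges (induced N (V (s (r n))))) (f (r n))"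
          using I.finite_edges c_pos by (intro energy_mono) (auto simp: induced_def less_imp_le)
        then show ?case using f(3)[of "r n"] by simp
      qed
      then show "energy N c S l \<le> a" using tendsto_upperbound[OF lim] by simp
    qed
    ultimately have "limit_cond N c e \<le> a" using l(2) limit_cond_le[of l a] by blast
    then show False using a by simp
  qed
qed

end

text \<open>The limit \<open>r\<close> is chosen before \<open>V\<close>: it is common to all
  exhaustions and to both boundary conditions. This uniformity is what produces a single limit
  measure.\<close>

theorem UST_power_tendsto:
  assumes "finite S"
  shows "\<exists>r. \<forall>V. exhaustion N V \<longrightarrow>
    (\<lambda>q. measure_pmf.expectation (UST (induced N (V q))) (\<lambda>t. 2 ^ card (t \<inter> S))) \<longlonglongrightarrow> r \<and>
    (\<lambda>q. measure_pmf.expectation (UST (wired N (V q))) (\<lambda>t. 2 ^ card (t \<inter> S))) \<longlonglongrightarrow> (r :: real)"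
proof -
  let ?c = "cond N"
  \<comment> \<open>The same quotient is needed twice because wiring changes the vertex
    type.\<close>
  define ratio :: "'e set \<Rightarrow> ('v, 'e) network \<Rightarrow> real"
    where "ratio S M = tree_sum M (double S ?c) / tree_sum M ?c" for S M
  define ratio' :: "'e set \<Rightarrow> ('v option, 'e) network \<Rightarrow> real"
    where "ratio' S M = tree_sum M (double S ?c) / tree_sum M ?c" for S M
  have fV: "finite (V q)" "connected_network (induced N (V q))" if "exhaustion N V" for V q
    using that by (auto simp: exhaustion_def)
  have posI: "?c e > 0" if "e \<in> edges (induced N V)" for e V using that cond_pos by (auto simp: induced_def)
  have posW: "?c e > 0" if "e \<in> edges (wired N V)" for e V using that cond_pos by (auto simp: wired_simps)
  have I: "measure_pmf.expectation (UST (induced N (V q))) (\<lambda>t. 2 ^ card (t \<inter> S)) = ratio S (induced N (V q))"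
    and W: "measure_pmf.expectation (UST (wired N (V q))) (\<lambda>t. 2 ^ card (t \<inter> S)) = ratio' S (wired N (V q))"
    if "exhaustion N V" for V q S
  proof -
    interpret I: finite_network "induced N (V q)" by (rule finite_network_induced[OF fV[OF that]])
    interpret W: finite_network "wired N (V q)" by (rule finite_network_wired[OF fV[OF that]])
    have ci: "cond (induced N (V q)) = ?c" by (simp add: induced_def)
    show "measure_pmf.expectation (UST (induced N (V q))) (\<lambda>t. 2 ^ card (t \<inter> S)) = ratio S (induced N (V q))"
      using I.UST_expectation_power[of S] posI by (simp add: ratio_def ci)
    show "measure_pmf.expectation (UST (wired N (V q))) (\<lambda>t. 2 ^ card (t \<inter> S)) = ratio' S (wired N (V q))"
      using W.UST_expectation_power[of S] posW by (simp add: ratio'_def wired_simps(4))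
  qed
  have "\<exists>r. \<forall>V. exhaustion N V \<longrightarrow>
    (\<lambda>q. ratio S (induced N (V q))) \<longlonglongrightarrow> r \<and> (\<lambda>q. ratio' S (wired N (V q))) \<longlonglongrightarrow> r"
    using assms
  proof (induction S)
    case empty
    have "ratio {} (induced N (V q)) = 1 \<and> ratio' {} (wired N (V q)) = 1" if "exhaustion N V" for V q
    proof -
      interpret I: finite_network "induced N (V q)" by (rule finite_network_induced[OF fV[OF that]])
      interpret W: finite_network "wired N (V q)" by (rule finite_network_wired[OF fV[OF that]])
      show ?thesis using I.tree_sum_pos[of ?c] W.tree_sum_pos[of ?c] posI posW
        by (simp add: ratio_def ratio'_def less_imp_neq[symmetric])
    qed
    then show ?case by (intro exI[of _ 1]) simp
  next
    case (insert e S)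
    obtain r where r: "\<And>V. exhaustion N V \<Longrightarrow> (\<lambda>q. ratio S (induced N (V q))) \<longlonglongrightarrow> r"
      "\<And>V. exhaustion N V \<Longrightarrow> (\<lambda>q. ratio' S (wired N (V q))) \<longlonglongrightarrow> r"
      using insert.IH by blast
    show ?case
    proof (cases "e \<in> edges N")
      case False
      have "ratio (insert e S) (induced N (V q)) = ratio S (induced N (V q)) \<and>
        ratio' (insert e S) (wired N (V q)) = ratio' S (wired N (V q))" if "exhaustion N V" for V q
      proof -
        interpret I: finite_network "induced N (V q)" by (rule finite_network_induced[OF fV[OF that]])
        interpret W: finite_network "wired N (V q)" by (rule finite_network_wired[OF fV[OF that]])
        show ?thesis
          using I.tree_sum_double_outside[of e S ?c] W.tree_sum_double_outside[of e S ?c] False insert.hyps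
          by (simp add: ratio_def ratio'_def wired_simps induced_def)
      qed
      then have "(\<lambda>q. ratio (insert e S) (induced N (V q))) = (\<lambda>q. ratio S (induced N (V q)))"
        "(\<lambda>q. ratio' (insert e S) (wired N (V q))) = (\<lambda>q. ratio' S (wired N (V q)))"
        if "exhaustion N V" for V
        using that by blast+
      then show ?thesis using r by metis
    next
      case e: True
      \<comment> \<open>Every edge is doubled at most once, so \<open>c\<close> stays within a
        factor two of the original conductances, as \<open>approx\<close> requires.\<close>
      define c where "c = double S ?c"
      have comp: "e \<in> edges N \<Longrightarrow> cond N e \<le> c e \<and> c e \<le> 2 * cond N e" for e
        using cond_pos[of e] by (simp add: c_def double_def)
      have L: "limit_cond N c e > 0" using limit_cond_pos[OF comp e] .
      define r' where "r' = r * (1 + c e / limit_cond N c e)"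
      have "(\<lambda>q. ratio (insert e S) (induced N (V q))) \<longlonglongrightarrow> r' \<and>
        (\<lambda>q. ratio' (insert e S) (wired N (V q))) \<longlonglongrightarrow> r'" if V: "exhaustion N V" for V
      proof
        have ev: "\<forall>\<^sub>F q in sequentially. set_uprod (ends N e) \<subseteq> V q" by (rule eventually_subset[OF V]) simp
        have "(\<lambda>q. ratio S (induced N (V q)) * (1 + c e / eff_cond (induced N (V q)) c e)) \<longlonglongrightarrow> r'"
          unfolding r'_def using L
          by (intro tendsto_intros r[OF V] induced_eff_cond_tendsto[OF comp e V]) auto
        moreover have "\<forall>\<^sub>F q in sequentially. ratio S (induced N (V q)) * (1 + c e / eff_cond (induced N (V q)) c e)
          = ratio (insert e S) (induced N (V q))"
          using ev
        proof eventually_elim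
          case (elim q)
          interpret I: finite_network "induced N (V q)" by (rule finite_network_induced[OF fV[OF V]])
          show ?case
            unfolding ratio_def c_def
            by (intro I.tree_sum_double_step[of ?c e S, symmetric] posI insert.hyps(2)
              induced_competitor(3,4)[OF comp e fV[OF V] elim])
        qed
        ultimately show "(\<lambda>q. ratio (insert e S) (induced N (V q))) \<longlonglongrightarrow> r'"
          by (rule Lim_transform_eventually)
        have "(\<lambda>q. ratio' S (wired N (V q)) * (1 + c e / eff_cond (wired N (V q)) c e)) \<longlonglongrightarrow> r'"
          unfolding r'_def using L
          by (intro tendsto_intros r[OF V] wired_eff_cond_tendsto[OF comp e V]) auto
        moreover have "\<forall>\<^sub>F q in sequentially. ratio' S (wired N (V q)) * (1 + c e / eff_cond (wired N (V q)) c e)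
          = ratio' (insert e S) (wired N (V q))"
          using ev
        proof eventually_elim
          case (elim q)
          interpret W: finite_network "wired N (V q)" by (rule finite_network_wired[OF fV[OF V]])
          show ?case
            unfolding ratio'_def c_def
            by (intro W.tree_sum_double_step[of ?c e S, symmetric] posW insert.hyps(2)
              wired_competitor(3,4)[OF comp e fV[OF V] elim])
        qed
        ultimately show "(\<lambda>q. ratio' (insert e S) (wired N (V q))) \<longlonglongrightarrow> r'"
          by (rule Lim_transform_eventually)
      qed
      then show ?thesis by blast
    qed
  qed
  moreover have "(\<lambda>q. measure_pmf.expectation (UST (induced N (V q))) (\<lambda>t. 2 ^ card (t \<inter> S)))
      = (\<lambda>q. ratio S (induced N (V q)))"
    "(\<lambda>q. measure_pmf.expectation (UST (wired N (V q))) (\<lambda>t. 2 ^ card (t \<inter> S)))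
      = (\<lambda>q. ratio' S (wired N (V q)))" if "exhaustion N V" for V
    using I[OF that] W[OF that] by blast+
  ultimately show ?thesis by metis
qed

end

subsection \<open>Weak limits of random edge sets\<close>

definition law :: "'e set pmf \<Rightarrow> ('e \<Rightarrow> bool) measure" where
  "law p = distr (measure_pmf p) borel (\<lambda>t e. e \<in> t)"

lemma UST_law_eq: "UST_law N = law (UST N)"
  by (simp add: UST_law_def law_def)

lemma integral_law:
  fixes f :: "('e \<Rightarrow> bool) \<Rightarrow> real"
  assumes "f \<in> borel_measurable borel"
  shows "integral\<^sup>L (law p) f = measure_pmf.expectation p (\<lambda>t. f (\<lambda>e. e \<in> t))"
  unfolding law_def using assms by (intro integral_distr) auto

section \<open>Cylinder events in the compact space of configurations\<close>

definition determined_by :: "'e set \<Rightarrow> ('e \<Rightarrow> bool) set \<Rightarrow> bool" where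
  "determined_by F C \<longleftrightarrow> (\<forall>\<omega> \<omega>'. (\<forall>e\<in>F. \<omega> e = \<omega>' e) \<longrightarrow> (\<omega> \<in> C \<longleftrightarrow> \<omega>' \<in> C))"

lemma determined_byD:
  "determined_by F C \<Longrightarrow> (\<And>e. e \<in> F \<Longrightarrow> \<omega> e = \<omega>' e) \<Longrightarrow> \<omega> \<in> C \<longleftrightarrow> \<omega>' \<in> C"
  unfolding determined_by_def by blast

definition cylinders :: "('e \<Rightarrow> bool) set set" where
  "cylinders = {C. \<exists>F. finite F \<and> determined_by F C}"

definition basic_cylinder :: "'e set \<Rightarrow> 'e set \<Rightarrow> ('e \<Rightarrow> bool) set" where
  "basic_cylinder F a = {\<omega>. \<forall>e\<in>F. \<omega> e \<longleftrightarrow> e \<in> a}"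

lemma basic_cylinder_in: "finite F \<Longrightarrow> basic_cylinder F a \<in> cylinders"
  by (auto simp: cylinders_def determined_by_def basic_cylinder_def)

lemma algebra_cylinders: "algebra UNIV cylinders"
  unfolding algebra_iff_Int
proof (intro conjI ballI)
  show "{} \<in> cylinders" by (auto simp: cylinders_def determined_by_def)
  show "UNIV - C \<in> cylinders" if "C \<in> cylinders" for C :: "('e \<Rightarrow> bool) set"
    using that by (fastforce simp: cylinders_def determined_by_def)
  show "C \<inter> D \<in> cylinders" if CD: "C \<in> cylinders" "D \<in> cylinders" for C D :: "('e \<Rightarrow> bool) set"
  proof -
    obtain F G where F: "finite F" "determined_by F C" and G: "finite G" "determined_by G D"
      using CD by (auto simp: cylinders_def)
    have "determined_by (F \<union> G) (C \<inter> D)"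
      unfolding determined_by_def
    proof (intro allI impI)
      fix \<omega> \<omega>' :: "'e \<Rightarrow> bool" assume eq: "\<forall>e\<in>F \<union> G. \<omega> e = \<omega>' e"
      have "\<omega> \<in> C \<longleftrightarrow> \<omega>' \<in> C" by (rule determined_byD[OF F(2)]) (use eq in simp)
      moreover have "\<omega> \<in> D \<longleftrightarrow> \<omega>' \<in> D" by (rule determined_byD[OF G(2)]) (use eq in simp)
      ultimately show "\<omega> \<in> C \<inter> D \<longleftrightarrow> \<omega>' \<in> C \<inter> D" by simp
    qed
    then show ?thesis using F(1) G(1) unfolding cylinders_def by blast
  qed
qed auto

lemma open_basic_cylinder: "finite F \<Longrightarrow> open (basic_cylinder F a)"
proof -
  assume "finite F"
  have "basic_cylinder F a = (\<Inter>e\<in>F. (\<lambda>\<omega>. \<omega> e) -` {e \<in> a})"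
    by (auto simp: basic_cylinder_def)
  moreover have "open ((\<lambda>\<omega>. \<omega> e) -` {b})" for e :: 'a and b :: bool
    by (intro open_vimage continuous_on_product_coordinates) (simp add: Topological_Spaces.open_discrete)
  ultimately show ?thesis using \<open>finite F\<close> by (auto intro: open_INT)
qed

lemma open_imp_basic_cylinder:
  assumes "open (A :: ('e \<Rightarrow> bool) set)" "\<omega> \<in> A"
  shows "\<exists>F. finite F \<and> basic_cylinder F {e. \<omega> e} \<subseteq> A"
proof -
  have "openin (product_topology (\<lambda>_. euclidean) UNIV) A"
    using assms(1) by (simp add: open_fun_def)
  then have "\<exists>U. finite {i \<in> UNIV. U i \<noteq> topspace euclidean} \<and>
      (\<forall>i\<in>UNIV. openin euclidean (U i)) \<and> \<omega> \<in> Pi\<^sub>E UNIV U \<and> Pi\<^sub>E UNIV U \<subseteq> A"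
    using assms(2) unfolding openin_product_topology_alt by (rule bspec)
  then obtain U where U: "finite {i. U i \<noteq> (UNIV :: bool set)}" "\<omega> \<in> Pi\<^sub>E UNIV U" "Pi\<^sub>E UNIV U \<subseteq> A"
    by (elim exE conjE) (rule that, simp)
  have "basic_cylinder {i. U i \<noteq> UNIV} {e. \<omega> e} \<subseteq> Pi\<^sub>E UNIV U"
  proof
    fix \<omega>' assume w: "\<omega>' \<in> basic_cylinder {i. U i \<noteq> UNIV} {e. \<omega> e}"
    have "\<omega>' i \<in> U i" for i
      using w U(2) by (cases "U i = UNIV") (auto simp: basic_cylinder_def PiE_iff)
    then show "\<omega>' \<in> Pi\<^sub>E UNIV U" by auto
  qed
  then show ?thesis using U(1,3) by (intro exI[of _ "{i. U i \<noteq> UNIV}"] conjI) (auto dest: subset_trans)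
qed

lemma determined_by_eq:
  assumes "determined_by F C"
  shows "C = (\<Union>a\<in>{a\<in>Pow F. (\<lambda>e. e \<in> a) \<in> C}. basic_cylinder F a)"
proof (intro equalityI subsetI)
  fix \<omega> assume w: "\<omega> \<in> C"
  have "\<omega> \<in> C \<longleftrightarrow> (\<lambda>e. e \<in> {e\<in>F. \<omega> e}) \<in> C"
    by (rule determined_byD[OF assms]) simp
  moreover have "\<omega> \<in> basic_cylinder F {e\<in>F. \<omega> e}" by (auto simp: basic_cylinder_def)
  ultimately show "\<omega> \<in> (\<Union>a\<in>{a\<in>Pow F. (\<lambda>e. e \<in> a) \<in> C}. basic_cylinder F a)"
    using w by (intro UN_I[of "{e\<in>F. \<omega> e}"]) auto
next
  fix \<omega> assume "\<omega> \<in> (\<Union>a\<in>{a\<in>Pow F. (\<lambda>e. e \<in> a) \<in> C}. basic_cylinder F a)"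
  then obtain a where a: "(\<lambda>e. e \<in> a) \<in> C" "\<omega> \<in> basic_cylinder F a" by blast
  have "\<omega> \<in> C \<longleftrightarrow> (\<lambda>e. e \<in> a) \<in> C"
    by (rule determined_byD[OF assms]) (use a(2) in \<open>simp add: basic_cylinder_def\<close>)
  then show "\<omega> \<in> C" using a by simp
qed

lemma open_cylinder: "C \<in> cylinders \<Longrightarrow> open C"
proof -
  assume "C \<in> cylinders"
  then obtain F where F: "finite F" "determined_by F C" by (auto simp: cylinders_def)
  show ?thesis by (subst determined_by_eq[OF F(2)]) (intro open_UN ballI open_basic_cylinder F(1))
qed

lemma closed_cylinder:
  assumes "C \<in> cylinders"
  shows "closed C"
proof -
  have "UNIV - C \<in> cylinders" by (rule algebra.compl_sets[OF algebra_cylinders assms])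
  then show ?thesis unfolding closed_def Compl_eq_Diff_UNIV by (rule open_cylinder)
qed

lemma borel_eq_cylinders: "sets (borel :: ('e :: countable \<Rightarrow> bool) measure) = sigma_sets UNIV cylinders"
proof
  have "A \<in> sigma_sets UNIV cylinders" if A: "open A" for A :: "('e \<Rightarrow> bool) set"
  proof -
    \<comment> \<open>Patterns are restricted to finite sets \<open>a\<close> to keep the union
      countable.\<close>
    define I where "I = {(F, a). finite F \<and> finite a \<and> basic_cylinder F a \<subseteq> A}"
    have "I \<subseteq> Collect finite \<times> Collect finite" by (auto simp: I_def)
    then have "countable I" by (rule countable_subset) (simp add: countable_Collect_finite)
    have "A = (\<Union>(F, a)\<in>I. basic_cylinder F a)"
    proof (intro equalityI subsetI)
      fix \<omega> assume "\<omega> \<in> A"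
      then obtain F where F: "finite F" "basic_cylinder F {e. \<omega> e} \<subseteq> A"
        using open_imp_basic_cylinder[OF A] by meson
      \<comment> \<open>Only the trace of the pattern on \<open>F\<close> matters, and that trace is
        finite.\<close>
      have "basic_cylinder F {e. \<omega> e} = basic_cylinder F {e\<in>F. \<omega> e}"
        by (auto simp: basic_cylinder_def)
      then have "(F, {e\<in>F. \<omega> e}) \<in> I" using F by (simp add: I_def)
      moreover have "\<omega> \<in> basic_cylinder F {e\<in>F. \<omega> e}" by (auto simp: basic_cylinder_def)
      ultimately show "\<omega> \<in> (\<Union>(F, a)\<in>I. basic_cylinder F a)" by (intro UN_I) auto
    qed (auto simp: I_def)
    moreover have "(\<Union>(F, a)\<in>I. basic_cylinder F a) \<in> sigma_sets UNIV cylinders"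
    proof (rule sigma_algebra.countable_UN')
      show "sigma_algebra UNIV (sigma_sets UNIV cylinders :: ('e \<Rightarrow> bool) set set)"
        by (rule sigma_algebra_sigma_sets) simp
    qed (use \<open>countable I\<close> basic_cylinder_in in \<open>auto simp: I_def intro!: sigma_sets.Basic\<close>)
    ultimately show ?thesis by simp
  qed
  then show "sets (borel :: ('e \<Rightarrow> bool) measure) \<subseteq> sigma_sets UNIV cylinders"
    unfolding borel_def
    by (auto intro!: sigma_sets_mono)
  show "sigma_sets UNIV cylinders \<subseteq> sets (borel :: ('e \<Rightarrow> bool) measure)"
    using open_cylinder sets.sigma_sets_subset[of "cylinders :: ('e \<Rightarrow> bool) set set" borel] by force
qed

lemma compact_configurations: "compact (UNIV :: ('e \<Rightarrow> bool) set)"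
proof -
  have "compactin (product_topology (\<lambda>_. euclidean) UNIV) (PiE UNIV (\<lambda>_ :: 'e. UNIV :: bool set))"
    by (simp only: compactin_PiE) (simp add: finite_imp_compact)
  then show ?thesis by (simp add: euclidean_product_topology)
qed

text \<open>Cylinders are closed in a compact space, so finitely many complements already cover it.
  This makes every finitely additive set function on cylinders continuous at the empty set.\<close>

lemma decseq_cylinders_empty:
  fixes A :: "nat \<Rightarrow> ('e \<Rightarrow> bool) set"
  assumes "range A \<subseteq> cylinders" "decseq A" "(\<Inter>i. A i) = {}"
  shows "\<exists>n. A n = {}"
proof -
  have op: "open (- A i)" for i
    by (intro open_Compl closed_cylinder subsetD[OF assms(1)] rangeI)
  have cov: "UNIV \<subseteq> (\<Union>i\<in>UNIV. - A i)"
  proof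
    fix \<omega>
    have "\<omega> \<notin> (\<Inter>i. A i)" unfolding assms(3) by simp
    then show "\<omega> \<in> (\<Union>i\<in>UNIV. - A i)" by simp
  qed
  obtain I where I: "finite I" "UNIV \<subseteq> (\<Union>i\<in>I. - A i)"
    by (rule compactE_image[OF compact_configurations op cov]) (rule that)
  have "A (Max (insert 0 I)) \<subseteq> A i" if "i \<in> I" for i
    by (rule decseqD[OF assms(2)]) (use I(1) that in simp)
  moreover have "\<exists>i\<in>I. \<omega> \<notin> A i" for \<omega>
    using subsetD[OF I(2), of \<omega>] by simp
  ultimately have "\<omega> \<notin> A (Max (insert 0 I))" for \<omega> by (meson subsetD)
  then have "A (Max (insert 0 I)) = {}" by (simp add: set_eq_iff)
  then show ?thesis ..
qed

text \<open>Compactness gives finitely many cylinders on each of which \<open>f\<close> varies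
  little; \<open>F\<close> collects their coordinates. Switching off the coordinates outside
  \<open>F\<close> keeps a configuration in the same cylinder.\<close>

lemma cylinder_approximation:
  fixes f :: "('e \<Rightarrow> bool) \<Rightarrow> real"
  assumes "continuous_on UNIV f" "\<epsilon> > 0"
  shows "\<exists>F. finite F \<and> (\<forall>\<omega>. \<bar>f \<omega> - f (\<lambda>e. e \<in> F \<and> \<omega> e)\<bar> \<le> \<epsilon>)"
proof -
  have "\<exists>F. finite F \<and> basic_cylinder F {e. \<omega> e} \<subseteq> {\<omega>'. \<bar>f \<omega>' - f \<omega>\<bar> < \<epsilon> / 2}" for \<omega>
  proof (rule open_imp_basic_cylinder)
    show "open {\<omega>'. \<bar>f \<omega>' - f \<omega>\<bar> < \<epsilon> / 2}"
      by (intro open_Collect_less continuous_intros assms(1))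
  qed (use assms(2) in auto)
  then have "\<exists>G. \<forall>\<omega>. finite (G \<omega>) \<and> basic_cylinder (G \<omega>) {e. \<omega> e} \<subseteq> {\<omega>'. \<bar>f \<omega>' - f \<omega>\<bar> < \<epsilon> / 2}"
    by (intro choice allI)
  then obtain G where G: "\<And>\<omega>. finite (G \<omega>)"
    "\<And>\<omega>. basic_cylinder (G \<omega>) {e. \<omega> e} \<subseteq> {\<omega>'. \<bar>f \<omega>' - f \<omega>\<bar> < \<epsilon> / 2}" by auto
  have op: "open (basic_cylinder (G \<omega>) {e. \<omega> e})" for \<omega> by (rule open_basic_cylinder[OF G(1)])
  have cov: "UNIV \<subseteq> (\<Union>\<omega>\<in>UNIV. basic_cylinder (G \<omega>) {e. \<omega> e})"
    by (intro subsetI UN_I) (auto simp: basic_cylinder_def)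
  obtain W where W: "finite W" "UNIV \<subseteq> (\<Union>\<omega>\<in>W. basic_cylinder (G \<omega>) {e. \<omega> e})"
    by (rule compactE_image[OF compact_configurations op cov]) (rule that)
  define F where "F = (\<Union>\<omega>\<in>W. G \<omega>)"
  have "\<bar>f \<omega> - f (\<lambda>e. e \<in> F \<and> \<omega> e)\<bar> \<le> \<epsilon>" for \<omega>
  proof -
    obtain w where w: "w \<in> W" "\<omega> \<in> basic_cylinder (G w) {e. w e}" using W(2) by auto
    then have "(\<lambda>e. e \<in> F \<and> \<omega> e) \<in> basic_cylinder (G w) {e. w e}"
      by (auto simp: basic_cylinder_def F_def)
    then have "\<bar>f (\<lambda>e. e \<in> F \<and> \<omega> e) - f w\<bar> < \<epsilon> / 2" "\<bar>f \<omega> - f w\<bar> < \<epsilon> / 2"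
      using G(2)[of w] w(2) by auto
    then show ?thesis by linarith
  qed
  moreover have "finite F" using W(1) G(1) by (simp add: F_def)
  ultimately show ?thesis by blast
qed

lemma restriction_eq_sum:
  fixes f :: "('e \<Rightarrow> bool) \<Rightarrow> real"
  assumes "finite F"
  shows "f (\<lambda>e. e \<in> F \<and> \<omega> e) = (\<Sum>a\<in>Pow F. f (\<lambda>e. e \<in> a) * indicator (basic_cylinder F a) \<omega>)"
proof -
  have "indicator (basic_cylinder F a) \<omega> = (if a = {e\<in>F. \<omega> e} then 1 else 0 :: real)" if "a \<in> Pow F" for a
    using that by (auto simp: basic_cylinder_def indicator_def)
  then have "(\<Sum>a\<in>Pow F. f (\<lambda>e. e \<in> a) * indicator (basic_cylinder F a) \<omega>)
      = (\<Sum>a\<in>Pow F. if a = {e\<in>F. \<omega> e} then f (\<lambda>e. e \<in> a) else 0)"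
    by (intro sum.cong) auto
  also have "\<dots> = f (\<lambda>e. e \<in> {e\<in>F. \<omega> e})"
    using assms by (subst sum.delta) auto
  finally show ?thesis by simp
qed

section \<open>Weak convergence through cylinder probabilities; uniqueness and existence of the
  limit law\<close>

lemma weakly_converges_cylinders:
  fixes \<mu> :: "nat \<Rightarrow> ('e :: countable \<Rightarrow> bool) measure"
  assumes M: "prob_space M" "sets M = sets borel"
    and \<mu>: "\<And>q. prob_space (\<mu> q)" "\<And>q. sets (\<mu> q) = sets borel"
    and lim: "\<And>C. C \<in> cylinders \<Longrightarrow> (\<lambda>q. measure (\<mu> q) C) \<longlonglongrightarrow> measure M C"
  shows "weakly_converges \<mu> M"
  unfolding weakly_converges_def
proof (intro allI impI)
  fix f :: "('e \<Rightarrow> bool) \<Rightarrow> real" assume f: "continuous_on UNIV f" "bounded (range f)"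
  obtain K where K: "\<And>\<omega>. \<bar>f \<omega>\<bar> \<le> K" using f(2) by (auto simp: bounded_iff)
  have fm: "f \<in> borel_measurable borel" using f(1) by (rule borel_measurable_continuous_onI)
  \<comment> \<open>The integral under \<open>P\<close> of \<open>f\<close> after all coordinates
    outside \<open>F\<close> are switched off; it involves finitely many cylinder probabilities
    only.\<close>
  define s where "s F P = (\<Sum>a\<in>Pow F. f (\<lambda>e. e \<in> a) * measure P (basic_cylinder F a))"
    for F and P :: "('e \<Rightarrow> bool) measure"
  have approx: "\<bar>integral\<^sup>L P f - s F P\<bar> \<le> \<epsilon>"
    if P: "prob_space P" "sets P = sets borel" and F: "finite F"
      and e: "\<And>\<omega>. \<bar>f \<omega> - f (\<lambda>e. e \<in> F \<and> \<omega> e)\<bar> \<le> \<epsilon>" for P F \<epsilon>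
  proof -
    interpret P: prob_space P by fact
    have bc: "basic_cylinder F a \<in> sets P" for a
      unfolding P(2) using open_basic_cylinder[OF F] by simp
    have sp: "space P = UNIV" using P(2) sets_eq_imp_space_eq[of P borel] by simp
    have fP: "f \<in> borel_measurable P" using fm measurable_cong_sets[OF P(2) refl] by blast
    have i1: "integrable P f" by (rule P.integrable_const_bound[of _ K]) (use K fP in auto)
    have ind: "integrable P (indicator (basic_cylinder F a) :: _ \<Rightarrow> real)" for a
      using bc[of a] by (intro integrable_real_indicator) (simp_all add: P.emeasure_eq_measure)
    have i2: "integrable P (\<lambda>\<omega>. f (\<lambda>e. e \<in> F \<and> \<omega> e))"
      unfolding restriction_eq_sum[OF F] using ind by (intro Bochner_Integration.integrable_sum) simp
    have "s F P = integral\<^sup>L P (\<lambda>\<omega>. f (\<lambda>e. e \<in> F \<and> \<omega> e))"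
      unfolding restriction_eq_sum[OF F] s_def
      using ind bc sp by (subst Bochner_Integration.integral_sum) auto
    then have "\<bar>integral\<^sup>L P f - s F P\<bar> = \<bar>\<integral>\<omega>. f \<omega> - f (\<lambda>e. e \<in> F \<and> \<omega> e) \<partial>P\<bar>"
      using i1 i2 by simp
    also have "\<dots> \<le> (\<integral>\<omega>. \<bar>f \<omega> - f (\<lambda>e. e \<in> F \<and> \<omega> e)\<bar> \<partial>P)"
      by (rule integral_abs_bound)
    also have "\<dots> \<le> (\<integral>\<omega>. \<epsilon> \<partial>P)"
      using i1 i2 e by (intro integral_mono) auto
    also have "\<dots> = \<epsilon>" by (simp add: P.prob_space)
    finally show ?thesis .
  qed
  show "(\<lambda>q. integral\<^sup>L (\<mu> q) f) \<longlonglongrightarrow> integral\<^sup>L M f"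
  proof (rule LIMSEQ_I)
    fix r :: real assume r: "r > 0"
    then obtain F where F: "finite F" "\<And>\<omega>. \<bar>f \<omega> - f (\<lambda>e. e \<in> F \<and> \<omega> e)\<bar> \<le> r / 4"
      using cylinder_approximation[OF f(1), of "r / 4"] by auto
    have "(\<lambda>q. s F (\<mu> q)) \<longlonglongrightarrow> s F M"
      unfolding s_def by (intro tendsto_sum tendsto_mult[OF tendsto_const] lim basic_cylinder_in F(1))
    then obtain q0 where q0: "\<And>q. q \<ge> q0 \<Longrightarrow> norm (s F (\<mu> q) - s F M) < r / 4"
      using r LIMSEQ_D[of "\<lambda>q. s F (\<mu> q)" "s F M" "r / 4"] by auto
    have "norm (integral\<^sup>L (\<mu> q) f - integral\<^sup>L M f) < r" if "q \<ge> q0" for q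
      using q0[OF that] approx[OF \<mu> F, of q] approx[OF M F] r unfolding real_norm_def by linarith
    then show "\<exists>q0. \<forall>q\<ge>q0. norm (integral\<^sup>L (\<mu> q) f - integral\<^sup>L M f) < r" by blast
  qed
qed

text \<open>Cylinders are both open and closed, so their indicators are continuous test functions;
  and they form an intersection-stable generator of the Borel sets.\<close>

lemma weak_limit_unique:
  fixes M M' :: "('e :: countable \<Rightarrow> bool) measure"
  assumes M: "prob_space M" "sets M = sets borel" "weakly_converges \<mu> M"
    and M': "prob_space M'" "sets M' = sets borel" "weakly_converges \<mu> M'"
  shows "M = M'"
proof -
  interpret algebra UNIV "cylinders :: ('e \<Rightarrow> bool) set set" by (rule algebra_cylinders)
  interpret M: prob_space M by fact
  interpret M': prob_space M' by fact
  have eq: "emeasure M C = emeasure M' C" if C: "C \<in> cylinders" for C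
  proof -
    have "open C" "closed C" using open_cylinder closed_cylinder C by auto
    have cont: "continuous_on UNIV (indicator C :: _ \<Rightarrow> real)"
      unfolding continuous_on_open_vimage[OF open_UNIV]
    proof (intro allI impI)
      fix B :: "real set"
      have "indicator C -` B \<inter> UNIV = (if 1 \<in> B then C else {}) \<union> (if 0 \<in> B then - C else {})"
        by (auto simp: indicator_def of_bool_def split: if_splits)
      then show "open (indicator C -` B \<inter> UNIV)"
        using \<open>open C\<close> \<open>closed C\<close> by (simp add: open_Un open_Compl)
    qed
    moreover have "bounded (range (indicator C :: _ \<Rightarrow> real))"
      by (rule boundedI[of _ 1]) (auto simp: indicator_def)
    ultimately have "(\<lambda>q. integral\<^sup>L (\<mu> q) (indicator C)) \<longlonglongrightarrow> integral\<^sup>L M (indicator C :: _ \<Rightarrow> real)"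
      "(\<lambda>q. integral\<^sup>L (\<mu> q) (indicator C)) \<longlonglongrightarrow> integral\<^sup>L M' (indicator C :: _ \<Rightarrow> real)"
      using M(3) M'(3) unfolding weakly_converges_def by blast+
    then have "integral\<^sup>L M (indicator C :: _ \<Rightarrow> real) = integral\<^sup>L M' (indicator C)"
      by (rule LIMSEQ_unique)
    moreover have "C \<in> sets M" "C \<in> sets M'" using \<open>open C\<close> M(2) M'(2) by auto
    ultimately show ?thesis
      by (simp add: M.emeasure_eq_measure M'.emeasure_eq_measure)
  qed
  show ?thesis
  proof (rule measure_eqI_generator_eq[where A = "\<lambda>_. UNIV"])
    show "Int_stable (cylinders :: ('e \<Rightarrow> bool) set set)" by (auto simp: Int_stable_def)
    show "range (\<lambda>_ :: nat. UNIV) \<subseteq> (cylinders :: ('e \<Rightarrow> bool) set set)" using top by auto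
    show "sets M = sigma_sets UNIV cylinders" "sets M' = sigma_sets UNIV cylinders"
      using M(2) M'(2) borel_eq_cylinders by simp_all
  qed (use eq in simp_all)
qed

text \<open>The weights \<open>2 ^ card (t \<inter> S)\<close> determine all cylinder probabilities because the indicators of
  \<open>e \<in> t\<close> and \<open>e \<notin> t\<close> are linear combinations of \<open>1\<close> and \<open>2 ^ of_bool (e \<in> t)\<close>.\<close>

lemma powers_determine_cylinders:
  fixes U :: "(nat \<Rightarrow> 'e set pmf) set"
  assumes lim: "\<And>S. finite S \<Longrightarrow> \<exists>r. \<forall>u\<in>U.
      (\<lambda>q. measure_pmf.expectation (u q) (\<lambda>t. 2 ^ card (t \<inter> S))) \<longlonglongrightarrow> (r :: real)"
    and C: "C \<in> cylinders"
  shows "\<exists>r. \<forall>u\<in>U. (\<lambda>q. measure (law (u q)) C) \<longlonglongrightarrow> r"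
proof -
  have int: "integrable (measure_pmf p) (\<lambda>t. of_bool (P t) * 2 ^ card (t \<inter> S) :: real)"
    if "finite S" for P S and p :: "'e set pmf"
    using that by (intro measure_pmf.integrable_const_bound[where B = "2 ^ card S"])
      (auto intro!: AE_I2 card_mono power_increasing simp: of_bool_def)
  have 1: "\<exists>r. \<forall>u\<in>U. (\<lambda>q. measure_pmf.expectation (u q) (\<lambda>t. of_bool (A \<subseteq> t) * 2 ^ card (t \<inter> S))) \<longlonglongrightarrow> (r :: real)"
    if "finite A" "finite S" "A \<inter> S = {}" for A S
    using that
  proof (induction A arbitrary: S)
    case empty
    then show ?case using lim by simp
  next
    case (insert a A)
    let ?E = "\<lambda>p S. measure_pmf.expectation p (\<lambda>t. of_bool (A \<subseteq> t) * 2 ^ card (t \<inter> S)) :: real"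
    obtain r where r: "\<forall>u\<in>U. (\<lambda>q. ?E (u q) S) \<longlonglongrightarrow> r" using insert.IH[of S] insert.prems by auto
    obtain r' where r': "\<forall>u\<in>U. (\<lambda>q. ?E (u q) (insert a S)) \<longlonglongrightarrow> r'"
      using insert.IH[of "insert a S"] insert.prems insert.hyps by auto
    have "of_bool (insert a A \<subseteq> t) * 2 ^ card (t \<inter> S)
      = of_bool (A \<subseteq> t) * 2 ^ card (t \<inter> insert a S) - (of_bool (A \<subseteq> t) * 2 ^ card (t \<inter> S) :: real)" for t
      using insert.prems by (cases "a \<in> t") auto
    then have eqn: "measure_pmf.expectation p (\<lambda>t. of_bool (insert a A \<subseteq> t) * 2 ^ card (t \<inter> S))
      = ?E p (insert a S) - ?E p S" for p
      using insert.prems int by (simp del: of_bool_conj)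
    show ?case
      unfolding eqn by (intro exI ballI) (rule tendsto_diff[OF bspec[OF r'] bspec[OF r]])
  qed
  \<comment> \<open>Absence of \<open>b\<close> is obtained by subtracting the event that
    \<open>b\<close> is present as well, so \<open>A\<close> has to vary in the induction.\<close>
  have 2: "\<exists>r. \<forall>u\<in>U. (\<lambda>q. measure_pmf.expectation (u q) (\<lambda>t. of_bool (A \<subseteq> t \<and> B \<inter> t = {}))) \<longlonglongrightarrow> (r :: real)"
    if "finite B" "finite A" for A B
    using that
  proof (induction B arbitrary: A)
    case empty
    then show ?case using 1[of A "{}"] by simp
  next
    case (insert b B)
    let ?E = "\<lambda>p A. measure_pmf.expectation p (\<lambda>t. of_bool (A \<subseteq> t \<and> B \<inter> t = {})) :: real"
    obtain r where r: "\<forall>u\<in>U. (\<lambda>q. ?E (u q) A) \<longlonglongrightarrow> r" using insert.IH[of A] insert.prems by auto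
    obtain r' where r': "\<forall>u\<in>U. (\<lambda>q. ?E (u q) (insert b A)) \<longlonglongrightarrow> r'"
      using insert.IH[of "insert b A"] insert.prems by auto
    have "of_bool (A \<subseteq> t \<and> insert b B \<inter> t = {})
      = of_bool (A \<subseteq> t \<and> B \<inter> t = {}) - (of_bool (insert b A \<subseteq> t \<and> B \<inter> t = {}) :: real)" for t
      by auto
    moreover have "integrable (measure_pmf p) (\<lambda>t. of_bool (P t) :: real)" for P and p :: "'e set pmf"
      using int[of "{}" p P] by simp
    ultimately have eqn: "measure_pmf.expectation p (\<lambda>t. of_bool (A \<subseteq> t \<and> insert b B \<inter> t = {}))
      = ?E p A - ?E p (insert b A)" for p
      by (simp del: of_bool_conj)
    show ?case
      unfolding eqn by (intro exI ballI) (rule tendsto_diff[OF bspec[OF r] bspec[OF r']])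
  qed
  obtain F where F: "finite F" "determined_by F C" using C by (auto simp: cylinders_def)
  \<comment> \<open>The traces on \<open>F\<close> of configurations in \<open>C\<close>.
    Prescribing the trace splits \<open>C\<close> into finitely many disjoint events.\<close>
  define I where "I = {a \<in> Pow F. (\<lambda>e. e \<in> a) \<in> C}"
  have fin: "finite I" using F(1) by (simp add: I_def)
  have "\<exists>r. \<forall>a\<in>I. \<forall>u\<in>U. (\<lambda>q. measure_pmf.expectation (u q)
    (\<lambda>t. of_bool (a \<subseteq> t \<and> (F - a) \<inter> t = {}))) \<longlonglongrightarrow> (r a :: real)"
  proof (intro bchoice ballI 2)
    show "finite (F - a)" for a using F(1) by simp
    show "finite a" if "a \<in> I" for a
      using that by (intro finite_subset[OF _ F(1)]) (simp add: I_def)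
  qed
  then obtain r where r: "\<forall>a\<in>I. \<forall>u\<in>U. (\<lambda>q. measure_pmf.expectation (u q)
    (\<lambda>t. of_bool (a \<subseteq> t \<and> (F - a) \<inter> t = {}))) \<longlonglongrightarrow> (r a :: real)" ..
  have eq: "measure (law p) C
    = (\<Sum>a\<in>I. measure_pmf.expectation p (\<lambda>t. of_bool (a \<subseteq> t \<and> (F - a) \<inter> t = {})))" for p
  proof -
    have "C \<in> sets borel" using open_cylinder[OF C] by simp
    then have "measure (law p) C = integral\<^sup>L (law p) (indicator C)"
      by (simp add: law_def)
    also have "\<dots> = measure_pmf.expectation p (\<lambda>t. indicator C (\<lambda>e. e \<in> t))"
      by (rule integral_law) (use \<open>C \<in> sets borel\<close> in simp)
    also have "\<dots> = measure_pmf.expectation p (\<lambda>t. \<Sum>a\<in>I. of_bool (a \<subseteq> t \<and> (F - a) \<inter> t = {}))"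
    proof (rule Bochner_Integration.integral_cong)
      fix t :: "'e set"
      have "(\<lambda>e. e \<in> t) \<in> C \<longleftrightarrow> (\<lambda>e. e \<in> t \<inter> F) \<in> C"
        by (rule determined_byD[OF F(2)]) simp
      then have "(\<lambda>e. e \<in> t) \<in> C \<longleftrightarrow> t \<inter> F \<in> I" by (simp add: I_def)
      moreover have "(a \<subseteq> t \<and> (F - a) \<inter> t = {}) \<longleftrightarrow> t \<inter> F = a" if "a \<in> I" for a
        using that by (auto simp: I_def)
      ultimately show "indicator C (\<lambda>e. e \<in> t) = (\<Sum>a\<in>I. of_bool (a \<subseteq> t \<and> (F - a) \<inter> t = {}) :: real)"
        using fin by (simp add: indicator_def of_bool_def cong: sum.cong)
    qed simp
    also have "\<dots> = (\<Sum>a\<in>I. measure_pmf.expectation p (\<lambda>t. of_bool (a \<subseteq> t \<and> (F - a) \<inter> t = {})))"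
      using int[of "{}"] by (intro Bochner_Integration.integral_sum) simp
    finally show ?thesis .
  qed
  have "\<forall>u\<in>U. (\<lambda>q. measure (law (u q)) C) \<longlonglongrightarrow> (\<Sum>a\<in>I. r a)"
    unfolding eq by (intro ballI tendsto_sum) (rule r[rule_format])
  then show ?thesis by blast
qed

text \<open>The limiting cylinder probabilities are additive, and decreasing cylinders with empty
  intersection are eventually empty, so Caratheodory extends them to a measure. The values do not
  depend on \<open>u\<close>, hence one measure is the limit of all sequences in
  \<open>U\<close>.\<close>

lemma weak_limit_exists:
  fixes U :: "(nat \<Rightarrow> 'e :: countable set pmf) set"
  assumes U: "U \<noteq> {}" and lim: "\<And>S. finite S \<Longrightarrow> \<exists>r. \<forall>u\<in>U.
      (\<lambda>q. measure_pmf.expectation (u q) (\<lambda>t. 2 ^ card (t \<inter> S))) \<longlonglongrightarrow> (r :: real)"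
  shows "\<exists>M. prob_space M \<and> sets M = sets borel \<and> (\<forall>u\<in>U. weakly_converges (\<lambda>q. law (u q)) M)"
proof -
  obtain u0 where u0: "u0 \<in> U" using U by blast
  interpret algebra UNIV "cylinders :: ('e \<Rightarrow> bool) set set" by (rule algebra_cylinders)
  obtain m where m: "\<And>C u. C \<in> cylinders \<Longrightarrow> u \<in> U \<Longrightarrow> (\<lambda>q. measure (law (u q)) C) \<longlonglongrightarrow> m C"
    using powers_determine_cylinders[OF lim] by metis
  have ps: "prob_space (law p)" for p :: "'e set pmf"
    unfolding law_def by (rule measure_pmf.prob_space_distr) simp
  have sl: "sets (law p) = sets borel" for p :: "'e set pmf" by (simp add: law_def)
  have cs: "C \<in> sets (law p)" if "C \<in> cylinders" for C and p :: "'e set pmf"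
    using open_cylinder[OF that] by (simp add: sl)
  have m0: "m C \<ge> 0" if "C \<in> cylinders" for C
    using m[OF that u0] by (rule LIMSEQ_le_const) simp
  have mE: "m {} = 0" using LIMSEQ_unique[OF m[OF empty_sets u0]] by simp
  have mU: "m UNIV = 1"
  proof (rule LIMSEQ_unique[OF m[OF top u0]])
    have "measure (law p) UNIV = 1" for p :: "'e set pmf"
      using prob_space.prob_space[OF ps[of p]] by (simp add: law_def)
    then show "(\<lambda>q. measure (law (u0 q)) UNIV) \<longlonglongrightarrow> 1" by simp
  qed
  have madd: "m (C \<union> D) = m C + m D" if CD: "C \<in> cylinders" "D \<in> cylinders" "C \<inter> D = {}" for C D
  proof (rule LIMSEQ_unique[OF m[OF Un[OF CD(1,2)] u0]])
    have "measure (law p) (C \<union> D) = measure (law p) C + measure (law p) D" for p :: "'e set pmf"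
    proof -
      interpret prob_space "law p" by (rule ps)
      show ?thesis using CD cs by (intro finite_measure_Union) auto
    qed
    then show "(\<lambda>q. measure (law (u0 q)) (C \<union> D)) \<longlonglongrightarrow> m C + m D"
      using tendsto_add[OF m[OF CD(1) u0] m[OF CD(2) u0]] by simp
  qed
  have pos: "positive cylinders (\<lambda>C. ennreal (m C))" by (simp add: positive_def mE)
  have "\<exists>\<nu> :: ('e \<Rightarrow> bool) set \<Rightarrow> ennreal. (\<forall>C\<in>cylinders. \<nu> C = ennreal (m C)) \<and>
      measure_space UNIV (sigma_sets UNIV cylinders) \<nu>"
  proof (rule caratheodory_empty_continuous[OF pos])
    show "additive cylinders (\<lambda>C. ennreal (m C))"
      by (auto simp: additive_def madd m0)
    fix A :: "nat \<Rightarrow> ('e \<Rightarrow> bool) set"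
    assume A: "range A \<subseteq> cylinders" "decseq A" "(\<Inter>i. A i) = {}"
    obtain n where n: "A n = {}" using decseq_cylinders_empty[OF A] by blast
    have "\<forall>\<^sub>F i in sequentially. ennreal (m (A i)) = 0"
      unfolding eventually_sequentially
    proof (intro exI allI impI)
      fix i assume "n \<le> i"
      then have "A i = {}" using A(2) n by (auto simp: decseq_def)
      then show "ennreal (m (A i)) = 0" by (simp add: mE)
    qed
    then show "(\<lambda>i. ennreal (m (A i))) \<longlonglongrightarrow> 0" by (rule tendsto_eventually)
  qed simp
  then obtain \<nu> where nu: "\<And>C. C \<in> cylinders \<Longrightarrow> \<nu> C = ennreal (m C)"
    "measure_space UNIV (sigma_sets UNIV cylinders) \<nu>" by blast
  define M where "M = measure_of UNIV (cylinders :: ('e \<Rightarrow> bool) set set) \<nu>"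
  have sM: "sets M = sets borel" by (simp add: M_def borel_eq_cylinders)
  have em: "emeasure M C = ennreal (m C)" if "C \<in> cylinders" for C
    using nu that by (simp add: M_def emeasure_measure_of measure_space_def)
  have pM: "prob_space M"
    by (rule prob_spaceI) (use em[OF top] in \<open>simp add: M_def mU\<close>)
  have mM: "measure M C = m C" if "C \<in> cylinders" for C
    using em[OF that] m0[OF that] by (simp add: measure_def)
  have "weakly_converges (\<lambda>q. law (u q)) M" if "u \<in> U" for u
    by (rule weakly_converges_cylinders[OF pM sM ps sl]) (simp add: mM m that)
  then show ?thesis using pM sM by blast
qed

text \<open>\<open>U\<close> gathers the free and wired sequences of all exhaustions, so one measure
  \<open>M\<close> meets both defining conditions. Uniqueness along a single exhaustion identifies
  both descriptions with \<open>M\<close>; membership is asserted too, since equality of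
  descriptions alone would say nothing about existence.\<close>

theorem (in approximable_network) WSF_eq_FSF:
  "is_WSF N (WSF N) \<and> is_FSF N (FSF N) \<and> WSF N = FSF N"
proof -
  define U where "U = {\<lambda>q. UST (induced N (V q)) | V. exhaustion N V} \<union> {\<lambda>q. UST (wired N (V q)) | V. exhaustion N V}"
  obtain V0 where V0: "exhaustion N V0" using exhaustion_exists by blast
  have "\<exists>M. prob_space M \<and> sets M = sets borel \<and> (\<forall>u\<in>U. weakly_converges (\<lambda>q. law (u q)) M)"
  proof (rule weak_limit_exists)
    show "U \<noteq> {}" using V0 by (auto simp: U_def)
    fix S :: "'e set" assume "finite S"
    then obtain r where "\<forall>V. exhaustion N V \<longrightarrow>
      (\<lambda>q. measure_pmf.expectation (UST (induced N (V q))) (\<lambda>t. 2 ^ card (t \<inter> S))) \<longlonglongrightarrow> r \<and>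
      (\<lambda>q. measure_pmf.expectation (UST (wired N (V q))) (\<lambda>t. 2 ^ card (t \<inter> S))) \<longlonglongrightarrow> (r :: real)"
      using UST_power_tendsto by blast
    then show "\<exists>r. \<forall>u\<in>U. (\<lambda>q. measure_pmf.expectation (u q) (\<lambda>t. 2 ^ card (t \<inter> S))) \<longlonglongrightarrow> (r :: real)"
      by (intro exI[of _ r]) (auto simp: U_def)
  qed
  then obtain M where M: "prob_space M" "sets M = sets borel"
    "\<And>u. u \<in> U \<Longrightarrow> weakly_converges (\<lambda>q. law (u q)) M" by blast
  have F: "is_FSF N M" and W: "is_WSF N M"
    using M by (auto simp: is_FSF_def is_WSF_def UST_law_eq U_def)
  have "FSF N = M"
    unfolding FSF_def
  proof (rule the_equality[where P = "is_FSF N", OF F])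
    fix M' assume "is_FSF N M'"
    then show "M' = M" using F V0 weak_limit_unique unfolding is_FSF_def by blast
  qed
  moreover have "WSF N = M"
    unfolding WSF_def
  proof (rule the_equality[where P = "is_WSF N", OF W])
    fix M' assume "is_WSF N M'"
    then show "M' = M" using W V0 weak_limit_unique unfolding is_WSF_def by blast
  qed
  ultimately show ?thesis using F W by simp
qed

subsection \<open>The lattice network\<close>

definition l1 :: "int ^ 'd \<Rightarrow> int" where
  "l1 x = (\<Sum>i\<in>UNIV. \<bar>x $ i\<bar>)"

definition vnorm :: "int \<times> (int ^ 'd) \<Rightarrow> int" where
  "vnorm v = \<bar>fst v\<bar> + l1 (snd v)"

lemma l1_nonneg: "l1 x \<ge> 0"
  by (simp add: l1_def sum_nonneg)

lemma l1_zero [simp]: "l1 0 = 0"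
  by (simp add: l1_def)

lemma l1_triangle: "l1 (x + y) \<le> l1 x + l1 y"
  unfolding l1_def sum.distrib[symmetric] by (intro sum_mono) simp

lemma l1_minus_commute: "l1 (x - y) = l1 (y - x)"
  by (simp add: l1_def abs_minus_commute)

lemma l1_eq_0: "l1 x = 0 \<longleftrightarrow> x = 0"
  by (simp add: l1_def sum_nonneg_eq_0_iff vec_eq_iff)

lemma vnorm_nonneg: "vnorm v \<ge> 0"
  using l1_nonneg[of "snd v"] by (simp add: vnorm_def)

lemma vnorm_eq_0: "vnorm v = 0 \<longleftrightarrow> v = 0"
  using l1_nonneg[of "snd v"] l1_eq_0[of "snd v"] by (auto simp: vnorm_def prod_eq_iff)

lemma lattice_adj_vnorm: "lattice_adj u v \<longleftrightarrow> vnorm (u - v) = 1"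
  by (simp add: lattice_adj_def vnorm_def l1_def)

lemma lattice_adj_sym: "lattice_adj u v \<longleftrightarrow> lattice_adj v u"
  by (simp add: lattice_adj_vnorm vnorm_def l1_minus_commute[of "snd u"] abs_minus_commute)

lemma lattice_adj_irrefl: "\<not> lattice_adj u u"
  by (simp add: lattice_adj_vnorm vnorm_def)

lemma vnorm_adj_le: "lattice_adj u v \<Longrightarrow> vnorm u \<le> vnorm v + 1"
  using l1_triangle[of "snd v" "snd u - snd v"] by (simp add: lattice_adj_vnorm vnorm_def)

lemma finite_l1_ball: "finite {x :: int ^ 'd. l1 x \<le> k}"
proof (rule finite_subset)
  show "{x :: int ^ 'd. l1 x \<le> k} \<subseteq> vec_lambda ` (PiE UNIV (\<lambda>_. {-k..k}))"
  proof
    fix x :: "int ^ 'd" assume x: "x \<in> {x. l1 x \<le> k}"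
    have "\<bar>x $ i\<bar> \<le> l1 x" for i
      unfolding l1_def by (rule member_le_sum) auto
    then have "-k \<le> x $ i \<and> x $ i \<le> k" for i using x order_trans[of "\<bar>x $ i\<bar>" "l1 x" k] by auto
    then have "vec_nth x \<in> PiE UNIV (\<lambda>_. {-k..k})" by auto
    then show "x \<in> vec_lambda ` (PiE UNIV (\<lambda>_. {-k..k}))"
      by (metis image_eqI vec_nth_inverse)
  qed
qed (intro finite_imageI finite_PiE, auto)

lemma finite_vnorm_ball: "finite {v :: int \<times> (int ^ 'd). vnorm v \<le> k}"
proof (rule finite_subset)
  show "{v :: int \<times> (int ^ 'd). vnorm v \<le> k} \<subseteq> {-k..k} \<times> {x. l1 x \<le> k}"
  proof
    fix v :: "int \<times> (int ^ 'd)" assume "v \<in> {v. vnorm v \<le> k}"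
    then show "v \<in> {-k..k} \<times> {x. l1 x \<le> k}"
      using l1_nonneg[of "snd v"] by (cases v) (auto simp: vnorm_def)
  qed
qed (simp add: finite_l1_ball)

text \<open>One nonzero coordinate moves a step towards zero.\<close>

lemma l1_descent:
  assumes "(x :: int ^ 'd) \<noteq> 0"
  obtains y where "l1 (x - y) = 1" "l1 y = l1 x - 1"
proof -
  obtain k where k: "x $ k \<noteq> 0" using assms by (auto simp: vec_eq_iff)
  define y where "y = (\<chi> i. if i = k then x $ i - sgn (x $ i) else x $ i)"
  have "l1 (x - y) = (\<Sum>i\<in>UNIV. if i = k then 1 else 0)"
    unfolding l1_def using k by (intro sum.cong) (auto simp: y_def sgn_if)
  moreover have "l1 x - l1 y = (\<Sum>i\<in>UNIV. if i = k then 1 else 0)"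
    unfolding l1_def sum_subtractf[symmetric] using k by (intro sum.cong) (auto simp: y_def sgn_if)
  ultimately show ?thesis using that[of y] by simp
qed

lemma vnorm_descent:
  assumes "(v :: int \<times> (int ^ 'd)) \<noteq> 0"
  obtains w where "lattice_adj v w" "vnorm w = vnorm v - 1"
proof (cases "snd v = 0")
  case True
  then have "fst v \<noteq> 0" using assms by (auto simp: prod_eq_iff)
  then show ?thesis
    using True by (intro that[of "(fst v - sgn (fst v), snd v)"])
      (auto simp: lattice_adj_vnorm vnorm_def sgn_if)
next
  case False
  then obtain y where "l1 (snd v - y) = 1" "l1 y = l1 (snd v) - 1" using l1_descent by blast
  then show ?thesis by (intro that[of "(fst v, y)"]) (auto simp: lattice_adj_vnorm vnorm_def)
qed

text \<open>Read off on the ray over the origin; by \<open>ray_tendsto\<close> a function of finite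
  energy has this limit along every vertical ray.\<close>

definition ray_limit :: "(int \<times> (int ^ 'd) \<Rightarrow> real) \<Rightarrow> real" where
  "ray_limit g = lim (\<lambda>m. g (int m, 0))"

text \<open>The common degree \<open>2 * (d + 1)\<close> of all vertices of the lattice.\<close>

definition lattice_degree :: "'d :: finite itself \<Rightarrow> nat" where
  "lattice_degree _ = card {v :: int \<times> (int ^ 'd). vnorm v = 1}"

text \<open>For positive \<open>r\<close> this is 1 up to norm \<open>r\<close>, 0 from norm
  \<open>2 * r\<close> on, and of slope \<open>1 / r\<close> in between.\<close>

definition cutoff :: "nat \<Rightarrow> int \<times> (int ^ 'd) \<Rightarrow> real" where
  "cutoff r v = max 0 (min 1 (2 - real_of_int (vnorm v) / real r))"

context
  fixes lam :: real
  assumes lam: "lam > 0"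
begin

abbreviation (input) L :: "(int \<times> (int ^ 'd), (int \<times> (int ^ 'd)) uprod) network" where
  "L \<equiv> lattice_network TYPE('d) lam"

lemma L_simps:
  "verts L = UNIV" "edges L = {Upair u v | u v. lattice_adj u v}" "ends L e = e"
  by (simp_all add: lattice_network_def)

lemma cond_L_Upair: "cond L (Upair u v) = exp (lam * of_int (max (fst u) (fst v)))"
  by (simp add: lattice_network_def)

lemma Upair_edge_iff: "Upair u v \<in> edges L \<longleftrightarrow> lattice_adj u v"
  unfolding L_simps mem_Collect_eq by (metis Upair_inject lattice_adj_sym)

lemma finite_L_edges_at: "finite {e \<in> edges L. v \<in> set_uprod (ends L e)}"
proof (rule finite_subset)
  show "{e \<in> edges L. v \<in> set_uprod (ends L e)} \<subseteq> Upair v ` {w. vnorm w \<le> vnorm v + 1}"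
  proof
    fix e assume e: "e \<in> {e \<in> edges L. v \<in> set_uprod (ends L e)}"
    then obtain w where w: "e = Upair v w" by (cases e) (auto simp: L_simps)
    then have "lattice_adj v w" using e by (simp add: Upair_edge_iff)
    then have "lattice_adj w v" by (simp only: lattice_adj_sym[of v w])
    then show "e \<in> Upair v ` {w. vnorm w \<le> vnorm v + 1}" using w vnorm_adj_le by blast
  qed
qed (simp add: finite_vnorm_ball)

text \<open>Descending towards the origin never leaves a ball, so balls induce connected
  networks.\<close>

lemma exhaustion_L: "exhaustion (L :: (int \<times> (int ^ 'd), _) network) (\<lambda>q. {v. vnorm v \<le> int q})"
proof -
  have conn: "connected_network (induced (L :: (int \<times> (int ^ 'd), _) network) {v. vnorm v \<le> int q})" for q
  proof -
    let ?V = "{v :: int \<times> (int ^ 'd). vnorm v \<le> int q}"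
    let ?E = "edges (induced L ?V)"
    have to_0: "(v, 0) \<in> reach (induced L ?V) ?E" if "v \<in> ?V" for v
      using that
    proof (induction "nat (vnorm v)" arbitrary: v)
      case 0
      then have "v = 0" using vnorm_nonneg[of v] vnorm_eq_0[of v] by simp
      then show ?case by simp
    next
      case (Suc n)
      then have "v \<noteq> 0" using vnorm_eq_0[of v] by auto
      then obtain w where w: "lattice_adj v w" "vnorm w = vnorm v - 1" by (rule vnorm_descent)
      then have "n = nat (vnorm w)" "w \<in> ?V" using Suc.hyps(2) Suc.prems by auto
      then have "(w, 0) \<in> reach (induced L ?V) ?E" by (rule Suc.hyps(1))
      moreover have "Upair v w \<in> ?E"
        using w Suc.prems Upair_edge_iff[of v w] by (auto simp: induced_def L_simps)
      then have "(v, w) \<in> reach (induced L ?V) ?E"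
        by (rule reach_edge) (simp add: induced_def L_simps)
      ultimately show ?case by (rule reach_trans[rotated])
    qed
    have conn: "(x, y) \<in> reach (induced L ?V) ?E" if "x \<in> ?V" "y \<in> ?V" for x y
      by (rule reach_trans[OF to_0[OF that(1)] reach_sym[OF to_0[OF that(2)]]])
    have verts: "verts (induced L ?V) = ?V" by (simp add: induced_def)
    have "0 \<in> ?V" using vnorm_eq_0[of "0 :: int \<times> (int ^ 'd)"] by simp
    then show ?thesis
      unfolding connected_network_def connects_iff verts using conn by blast
  qed
  moreover have "incseq (\<lambda>q. {v :: int \<times> (int ^ 'd). vnorm v \<le> int q})"
    by (rule incseq_SucI) auto
  moreover have "v \<in> (\<Union>q. {v. vnorm v \<le> int q})" for v :: "int \<times> (int ^ 'd)"
    by (rule UN_I[of "nat (vnorm v)"]) auto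
  ultimately show ?thesis
    unfolding exhaustion_def L_simps(1) using finite_vnorm_ball by blast
qed

text \<open>The total resistance of a vertical ray above level \<open>n\<close> is \<open>exp (- lam * n)\<close> times
  this constant.\<close>

definition ray_const :: real where
  "ray_const = 1 / (1 - exp (- lam))"

lemma ray_const_pos: "ray_const > 0"
  using lam by (simp add: ray_const_def)

lemma exp_mult_le_imp:
  assumes "exp (lam * real m) * t \<le> B"
  shows "t \<le> B * exp (- lam) ^ m"
proof -
  have e: "exp (- lam) ^ m = exp (- (lam * real m))"
    unfolding exp_of_nat_mult[symmetric] by (simp add: mult.commute)
  have "t = exp (lam * real m) * t * exp (- (lam * real m))"
    by (simp add: exp_minus)
  also have "\<dots> \<le> B * exp (- (lam * real m))" by (rule mult_right_mono[OF assms]) simp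
  finally show ?thesis by (simp only: e)
qed

text \<open>Cauchy-Schwarz for resistors in series: a squared potential drop is at most the total
  resistance times the energy. The exponent contains \<open>real j + 1\<close> because the
  conductance of an edge is taken at its upper end.\<close>

lemma ray_diff_bound:
  fixes a :: "nat \<Rightarrow> real" and n :: real
  shows "exp (lam * n) * (a 0 - a m)\<^sup>2
    \<le> ray_const * (\<Sum>j<m. exp (lam * (n + real j + 1)) * (a j - a (Suc j))\<^sup>2)"
proof -
  define w where "w j = exp (lam * (n + real j + 1))" for j
  have w: "w j > 0" for j by (simp add: w_def)
  have "(a 0 - a m)\<^sup>2 = (\<Sum>j<m. a j - a (Suc j))\<^sup>2" by (simp add: sum_lessThan_telescope')
  also have "\<dots> = (\<Sum>j<m. (1 / sqrt (w j)) * (sqrt (w j) * (a j - a (Suc j))))\<^sup>2"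
    using w by (intro arg_cong[of _ _ "\<lambda>x. x\<^sup>2"] sum.cong) (auto simp: less_imp_neq[symmetric])
  also have "\<dots> \<le> (\<Sum>j<m. (1 / sqrt (w j))\<^sup>2) * (\<Sum>j<m. (sqrt (w j) * (a j - a (Suc j)))\<^sup>2)"
    by (rule Cauchy_Schwarz_ineq_sum)
  also have "(\<Sum>j<m. (sqrt (w j) * (a j - a (Suc j)))\<^sup>2) = (\<Sum>j<m. w j * (a j - a (Suc j))\<^sup>2)"
    using w by (intro sum.cong) (auto simp: power_mult_distrib less_imp_le)
  also have "(\<Sum>j<m. (1 / sqrt (w j))\<^sup>2) = (\<Sum>j<m. 1 / w j)"
    using w by (intro sum.cong) (auto simp: power_divide less_imp_le)
  also have "(\<Sum>j<m. 1 / w j) \<le> exp (- lam * n) * ray_const"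
  proof -
    have "1 / w j = exp (- lam * n) * (exp (- lam) * exp (- lam) ^ j)" for j
      by (simp add: w_def exp_of_nat_mult[symmetric] mult_exp_exp divide_inverse exp_minus[symmetric] algebra_simps)
    then have "(\<Sum>j<m. 1 / w j) = exp (- lam * n) * (exp (- lam) * (\<Sum>j<m. exp (- lam) ^ j))"
      by (simp add: sum_distrib_left)
    also have "(\<Sum>j<m. exp (- lam) ^ j) = (1 - exp (- lam) ^ m) / (1 - exp (- lam))"
      using lam by (simp add: sum_gp_strict)
    \<comment> \<open>The remaining factor \<open>exp (- lam)\<close> of the geometric sum is
      bounded by 1, so \<open>ray_const\<close> is an upper bound for the resistance factor.\<close>
    also have "exp (- lam) * ((1 - exp (- lam) ^ m) / (1 - exp (- lam))) \<le> 1 * (1 / (1 - exp (- lam)))"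
      using lam power_le_one[of "exp (- lam)" m]
      by (intro mult_mono divide_right_mono divide_nonneg_nonneg) auto
    finally show ?thesis by (simp add: ray_const_def)
  qed
  finally have "(a 0 - a m)\<^sup>2 \<le> exp (- lam * n) * ray_const * (\<Sum>j<m. w j * (a j - a (Suc j))\<^sup>2)"
    using w by (simp add: sum_nonneg less_imp_le mult_right_mono)
  then have "exp (lam * n) * (a 0 - a m)\<^sup>2
      \<le> exp (lam * n) * (exp (- lam * n) * ray_const * (\<Sum>j<m. w j * (a j - a (Suc j))\<^sup>2))"
    by (rule mult_left_mono) simp
  also have "\<dots> = ray_const * (\<Sum>j<m. w j * (a j - a (Suc j))\<^sup>2)"
    by (simp add: mult.assoc[symmetric] mult_exp_exp)
  finally show ?thesis by (simp add: w_def)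
qed

section \<open>Functions of finite energy along the vertical rays\<close>

context
  fixes g :: "int \<times> (int ^ 'd) \<Rightarrow> real" and K :: real
  assumes energy: "energy_le L (cond L) g K"
begin

lemma K_nonneg: "K \<ge> 0"
  using energy[unfolded energy_le_def, rule_format, of "{}"] by (simp add: energy_def)

text \<open>Rays over different \<open>x\<close> share no edge, so their energies add up to at most
  \<open>K\<close>. Hence the bound depends neither on the size of \<open>X\<close> nor on the
  levels.\<close>

lemma level_diff_bound:
  assumes X: "finite X" and nM: "n \<le> M"
  shows "(\<Sum>x\<in>X. exp (lam * of_int n) * (g (n, x) - g (M, x))\<^sup>2) \<le> ray_const * K"
proof -
  define m where "m = nat (M - n)"
  define e where "e = (\<lambda>(x, j). Upair (n + int j, x) (n + int j + 1, x) :: (int \<times> (int ^ 'd)) uprod)"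
  have inj: "inj_on e (X \<times> {..<m})"
    by (rule inj_onI) (auto simp: e_def)
  have S: "e ` (X \<times> {..<m}) \<subseteq> edges L"
    by (auto simp: e_def Upair_edge_iff lattice_adj_vnorm vnorm_def)
  have summand: "cond L (e (x, j)) * (edge_diff g (ends L (e (x, j))))\<^sup>2
      = exp (lam * (of_int n + real j + 1)) * (g (n + int j, x) - g (n + int (Suc j), x))\<^sup>2" for x j
    by (simp add: e_def cond_L_Upair L_simps(3) ac_simps)
  have "(\<Sum>x\<in>X. exp (lam * of_int n) * (g (n, x) - g (M, x))\<^sup>2)
    \<le> (\<Sum>x\<in>X. ray_const * (\<Sum>j<m. exp (lam * (of_int n + real j + 1)) * (g (n + int j, x) - g (n + int (Suc j), x))\<^sup>2))"
  proof (rule sum_mono)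
    fix x
    show "exp (lam * of_int n) * (g (n, x) - g (M, x))\<^sup>2
      \<le> ray_const * (\<Sum>j<m. exp (lam * (of_int n + real j + 1)) * (g (n + int j, x) - g (n + int (Suc j), x))\<^sup>2)"
      using ray_diff_bound[of "of_int n" "\<lambda>j. g (n + int j, x)" m] nM by (simp add: m_def)
  qed
  also have "\<dots> = ray_const * (\<Sum>x\<in>X. \<Sum>j<m. cond L (e (x, j)) * (edge_diff g (ends L (e (x, j))))\<^sup>2)"
    unfolding summand sum_distrib_left ..
  also have "(\<Sum>x\<in>X. \<Sum>j<m. cond L (e (x, j)) * (edge_diff g (ends L (e (x, j))))\<^sup>2)
    = energy L (cond L) (e ` (X \<times> {..<m})) g"
    unfolding energy_def by (simp add: sum.reindex[OF inj] sum.cartesian_product case_prod_unfold)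
  also have "ray_const * \<dots> \<le> ray_const * K"
    using energy S X ray_const_pos by (intro mult_left_mono) (auto simp: energy_le_def)
  finally show ?thesis .
qed

lemma ray_convergent: "convergent (\<lambda>m. g (int m, x))"
proof -
  have small: "(\<lambda>m. ray_const * K * exp (- lam) ^ m) \<longlonglongrightarrow> 0"
    using lam by (intro tendsto_mult_right_zero LIMSEQ_power_zero) simp
  have "Cauchy (\<lambda>m. g (int m, x))"
  proof (rule CauchyI')
    fix \<epsilon> :: real assume "\<epsilon> > 0"
    then have "\<forall>\<^sub>F m in sequentially. ray_const * K * exp (- lam) ^ m < \<epsilon>\<^sup>2"
      by (intro order_tendstoD(2)[OF small]) simp
    then obtain M where M: "\<And>m. m \<ge> M \<Longrightarrow> ray_const * K * exp (- lam) ^ m < \<epsilon>\<^sup>2"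
      by (auto simp: eventually_sequentially)
    have "dist (g (int m, x)) (g (int n, x)) < \<epsilon>" if "m \<ge> M" "n > m" for m n
    proof -
      have "exp (lam * real m) * (g (int m, x) - g (int n, x))\<^sup>2 \<le> ray_const * K"
        using level_diff_bound[of "{x}" "int m" "int n"] that by simp
      then have "(g (int m, x) - g (int n, x))\<^sup>2 \<le> ray_const * K * exp (- lam) ^ m"
        by (rule exp_mult_le_imp)
      also have "\<dots> < \<epsilon>\<^sup>2" by (rule M[OF that(1)])
      finally have "\<bar>g (int m, x) - g (int n, x)\<bar>\<^sup>2 < \<epsilon>\<^sup>2" unfolding power2_abs .
      then have "\<bar>g (int m, x) - g (int n, x)\<bar> < \<epsilon>"
        by (rule power2_less_imp_less) (use \<open>\<epsilon> > 0\<close> in simp)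
      then show ?thesis by (simp add: dist_real_def)
    qed
    then show "\<exists>M. \<forall>m\<ge>M. \<forall>n>m. dist (g (int m, x)) (g (int n, x)) < \<epsilon>"
      by (intro exI[of _ M] allI impI)
  qed
  then show ?thesis by (simp add: Cauchy_convergent_iff)
qed

text \<open>The single horizontal edge at level \<open>m\<close> has conductance
  \<open>exp (lam * m)\<close> and energy at most \<open>K\<close>, which forces the difference
  across it to zero.\<close>

lemma ray_limits_adjacent:
  assumes "l1 (x - y) = 1"
  shows "lim (\<lambda>m. g (int m, x)) = lim (\<lambda>m. g (int m, y))"
proof -
  have bound: "(g (int m, x) - g (int m, y))\<^sup>2 \<le> K * exp (- lam) ^ m" for m
  proof -
    have adj: "Upair (int m, x) (int m, y) \<in> edges L"
      using assms by (simp add: Upair_edge_iff lattice_adj_vnorm vnorm_def)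
    have "energy L (cond L) {Upair (int m, x) (int m, y)} g \<le> K"
      using energy adj unfolding energy_le_def by blast
    then have "exp (lam * real m) * (g (int m, x) - g (int m, y))\<^sup>2 \<le> K"
      by (simp add: energy_def L_simps(3) cond_L_Upair)
    then show ?thesis by (rule exp_mult_le_imp)
  qed
  have "(\<lambda>m. K * exp (- lam) ^ m) \<longlonglongrightarrow> 0"
    using lam by (intro tendsto_mult_right_zero LIMSEQ_power_zero) simp
  then have "(\<lambda>m. (g (int m, x) - g (int m, y))\<^sup>2) \<longlonglongrightarrow> 0"
    by (rule tendsto_sandwich[OF _ _ tendsto_const, rotated 2]) (use bound in auto)
  moreover have "(\<lambda>m. (g (int m, x) - g (int m, y))\<^sup>2)
    \<longlonglongrightarrow> (lim (\<lambda>m. g (int m, x)) - lim (\<lambda>m. g (int m, y)))\<^sup>2"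
    using ray_convergent by (intro tendsto_power tendsto_diff) (simp_all add: convergent_LIMSEQ_iff)
  ultimately have "(lim (\<lambda>m. g (int m, x)) - lim (\<lambda>m. g (int m, y)))\<^sup>2 = 0"
    by (rule LIMSEQ_unique[rotated])
  then show ?thesis by simp
qed

lemma ray_tendsto: "(\<lambda>m. g (int m, x)) \<longlonglongrightarrow> ray_limit g"
proof -
  have "lim (\<lambda>m. g (int m, x)) = ray_limit g"
  proof (induction "nat (l1 x)" arbitrary: x)
    case 0
    then have "x = 0" using l1_nonneg[of x] l1_eq_0[of x] by simp
    then show ?case by (simp add: ray_limit_def)
  next
    case (Suc n)
    then have "x \<noteq> 0" using l1_eq_0[of x] by auto
    then obtain y where y: "l1 (x - y) = 1" "l1 y = l1 x - 1" by (rule l1_descent)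
    then have "n = nat (l1 y)" using Suc.hyps(2) by auto
    then show ?case using Suc.hyps(1) ray_limits_adjacent[OF y(1)] by simp
  qed
  then show ?thesis using ray_convergent[of x] by (simp add: convergent_LIMSEQ_iff)
qed

lemma level_bound:
  assumes "finite X"
  shows "(\<Sum>x\<in>X. exp (lam * of_int n) * (g (n, x) - ray_limit g)\<^sup>2) \<le> ray_const * K"
proof (rule tendsto_upperbound)
  show "(\<lambda>M. \<Sum>x\<in>X. exp (lam * of_int n) * (g (n, x) - g (int M, x))\<^sup>2)
    \<longlonglongrightarrow> (\<Sum>x\<in>X. exp (lam * of_int n) * (g (n, x) - ray_limit g)\<^sup>2)"
    by (intro tendsto_intros ray_tendsto)
  have "(\<Sum>x\<in>X. exp (lam * of_int n) * (g (n, x) - g (int M, x))\<^sup>2) \<le> ray_const * K" if "M \<ge> nat n" for M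
    using that by (intro level_diff_bound[OF assms]) linarith
  then show "\<forall>\<^sub>F M in sequentially. (\<Sum>x\<in>X. exp (lam * of_int n) * (g (n, x) - g (int M, x))\<^sup>2) \<le> ray_const * K"
    unfolding eventually_sequentially by blast
qed simp

text \<open>The ball meets \<open>2 * k + 1\<close> levels and each contributes at most
  \<open>ray_const * K\<close>, however many points of the level lie in the ball.\<close>

lemma ball_bound:
  "(\<Sum>v\<in>{v. vnorm v \<le> int k}. exp (lam * of_int (fst v)) * (g v - ray_limit g)\<^sup>2)
    \<le> (2 * real k + 1) * (ray_const * K)"
proof -
  let ?X = "{x :: int ^ 'd. l1 x \<le> int k}"
  have "{v. vnorm v \<le> int k} \<subseteq> {- int k..int k} \<times> ?X"
  proof
    fix v :: "int \<times> (int ^ 'd)" assume "v \<in> {v. vnorm v \<le> int k}"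
    then show "v \<in> {- int k..int k} \<times> ?X"
      using l1_nonneg[of "snd v"] by (cases v) (auto simp: vnorm_def)
  qed
  then have "(\<Sum>v\<in>{v. vnorm v \<le> int k}. exp (lam * of_int (fst v)) * (g v - ray_limit g)\<^sup>2)
      \<le> (\<Sum>v\<in>{- int k..int k} \<times> ?X. exp (lam * of_int (fst v)) * (g v - ray_limit g)\<^sup>2)"
    by (intro sum_mono2) (auto simp: finite_l1_ball)
  also have "\<dots> = (\<Sum>n\<in>{- int k..int k}. \<Sum>x\<in>?X. exp (lam * of_int n) * (g (n, x) - ray_limit g)\<^sup>2)"
    by (simp add: sum.cartesian_product case_prod_unfold)
  also have "\<dots> \<le> (\<Sum>n\<in>{- int k..int k}. ray_const * K)"
    by (intro sum_mono level_bound finite_l1_ball)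
  also have "\<dots> = (2 * real k + 1) * (ray_const * K)" by simp
  finally show ?thesis .
qed

text \<open>Each edge is charged to its second end \<open>v\<close>. The levels of its ends differ
  by at most one, which costs a factor \<open>exp lam\<close>; sending an edge to \<open>v\<close>
  and its direction is injective, so \<open>v\<close> is charged at most
  \<open>lattice_degree\<close> times.\<close>

lemma edge_ball_bound:
  assumes S: "finite S" "S \<subseteq> edges L" and ball: "\<And>e. e \<in> S \<Longrightarrow> vnorm (snd (orient e)) \<le> int k"
    and c: "\<And>e. e \<in> S \<Longrightarrow> c e \<le> 2 * cond L e"
  shows "(\<Sum>e\<in>S. c e * (g (snd (orient e)) - ray_limit g)\<^sup>2)
    \<le> 2 * exp lam * real (lattice_degree TYPE('d)) * ((2 * real k + 1) * (ray_const * K))"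
proof -
  let ?B = "{v :: int \<times> (int ^ 'd). vnorm v \<le> int k}" and ?D = "{v :: int \<times> (int ^ 'd). vnorm v = 1}"
  define F where "F v = 2 * exp lam * (exp (lam * of_int (fst v)) * (g v - ray_limit g)\<^sup>2)" for v
  have adj: "lattice_adj (fst (orient e)) (snd (orient e))" if "e \<in> S" for e
    using S(2) that Upair_orient[of e] by (metis Upair_edge_iff subsetD)
  have fin: "finite ?D" by (rule finite_subset[OF _ finite_vnorm_ball[of 1]]) auto
  define j where "j e = (snd (orient e), fst (orient e) - snd (orient e))" for e :: "(int \<times> (int ^ 'd)) uprod"
  have inj: "inj_on j S"
  proof (rule inj_onI)
    fix e e' assume "j e = j e'"
    then have "fst (orient e) = fst (orient e')" "snd (orient e) = snd (orient e')"
      by (auto simp: j_def)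
    then show "e = e'" by (metis Upair_orient)
  qed
  have "(\<Sum>e\<in>S. c e * (g (snd (orient e)) - ray_limit g)\<^sup>2) \<le> (\<Sum>e\<in>S. F (fst (j e)))"
  proof (rule sum_mono)
    fix e assume e: "e \<in> S"
    define u v where "u = fst (orient e)" and "v = snd (orient e)"
    have ev: "e = Upair u v" by (simp add: u_def v_def Upair_orient)
    have "\<bar>fst u - fst v\<bar> \<le> 1"
      using adj[OF e] l1_nonneg[of "snd u - snd v"] by (simp add: lattice_adj_vnorm vnorm_def u_def v_def)
    then have "real_of_int (max (fst u) (fst v)) \<le> 1 + real_of_int (fst v)" by linarith
    then have "lam * of_int (max (fst u) (fst v)) \<le> lam * (1 + of_int (fst v))"
      using lam by (intro mult_left_mono) auto
    then have "cond L e \<le> exp (lam * (1 + of_int (fst v)))" by (simp add: ev cond_L_Upair)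
    also have "\<dots> = exp lam * exp (lam * of_int (fst v))" by (simp add: mult_exp_exp algebra_simps)
    finally have "c e \<le> 2 * exp lam * exp (lam * of_int (fst v))" using c[OF e] by simp
    then have "c e * (g v - ray_limit g)\<^sup>2 \<le> 2 * exp lam * exp (lam * of_int (fst v)) * (g v - ray_limit g)\<^sup>2"
      by (rule mult_right_mono) simp
    then show "c e * (g (snd (orient e)) - ray_limit g)\<^sup>2 \<le> F (fst (j e))"
      by (simp add: F_def j_def v_def mult.assoc)
  qed
  also have "\<dots> = (\<Sum>p\<in>j ` S. F (fst p))" by (simp add: sum.reindex[OF inj])
  also have "\<dots> \<le> (\<Sum>p\<in>?B \<times> ?D. F (fst p))"
  proof (rule sum_mono2)
    show "j ` S \<subseteq> ?B \<times> ?D" using adj ball by (auto simp: j_def lattice_adj_vnorm)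
  qed (auto simp: F_def fin finite_vnorm_ball)
  also have "\<dots> = (\<Sum>v\<in>?B. \<Sum>w\<in>?D. F v)"
    by (simp only: sum.cartesian_product case_prod_unfold)
  also have "\<dots> = 2 * exp lam * real (lattice_degree TYPE('d)) * (\<Sum>v\<in>?B. exp (lam * of_int (fst v)) * (g v - ray_limit g)\<^sup>2)"
    by (simp add: lattice_degree_def F_def sum_distrib_left mult_ac)
  also have "\<dots> \<le> 2 * exp lam * real (lattice_degree TYPE('d)) * ((2 * real k + 1) * (ray_const * K))"
    by (intro mult_left_mono ball_bound) auto
  finally show ?thesis .
qed

section \<open>Energy of the cutoff function and the approximation property of the lattice\<close>

lemma cutoff_lipschitz:
  assumes "lattice_adj u v" "r > 0"
  shows "(cutoff r u - cutoff r v)\<^sup>2 \<le> 1 / (real r)\<^sup>2"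
proof -
  have "\<bar>real_of_int (vnorm u) - real_of_int (vnorm v)\<bar> \<le> 1"
    using vnorm_adj_le[OF assms(1)] vnorm_adj_le[of v u] assms(1) lattice_adj_sym[of u v] by linarith
  then have "\<bar>real_of_int (vnorm u) / real r - real_of_int (vnorm v) / real r\<bar> \<le> 1 / real r"
    using assms(2) by (simp add: diff_divide_distrib[symmetric] divide_right_mono)
  then have "\<bar>cutoff r u - cutoff r v\<bar> \<le> 1 / real r"
    unfolding cutoff_def by linarith
  then have "\<bar>cutoff r u - cutoff r v\<bar>\<^sup>2 \<le> (1 / real r)\<^sup>2" by (rule power_mono) simp
  then show ?thesis by (simp add: power_divide)
qed

text \<open>The product rule splits each difference into a cut-off difference of \<open>g\<close>
  and a term with the difference of the cutoff. Young's inequality with weight \<open>\<eta>\<close>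
  keeps the coefficient of the energy of \<open>g\<close> close to 1, since the approximation may
  exceed it only by a small amount.\<close>

lemma cutoff_energy:
  assumes S: "finite S" "S \<subseteq> edges L" and r: "r > 0" and eta: "\<eta> > 0"
    and c: "\<And>e. e \<in> S \<Longrightarrow> 0 \<le> c e \<and> c e \<le> 2 * cond L e"
  shows "energy L c S (\<lambda>v. ray_limit g + cutoff r v * (g v - ray_limit g))
    \<le> (1 + \<eta>) * energy L c S g
      + (1 + 1 / \<eta>) * (2 * exp lam * real (lattice_degree TYPE('d)) * ((4 * real r + 3) * (ray_const * K))) / (real r)\<^sup>2"
proof -
  define h where "h v = ray_limit g + cutoff r v * (g v - ray_limit g)" for v
  define u v where "u e = fst (orient e)" and "v e = snd (orient e)" for e :: "(int \<times> (int ^ 'd)) uprod"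
  define d where "d e = (cutoff r (u e) - cutoff r (v e))\<^sup>2 * (g (v e) - ray_limit g)\<^sup>2" for e
  \<comment> \<open>An edge whose second end lies beyond radius \<open>2 * r + 1\<close> has both
    ends where the cutoff vanishes. With this radius \<open>ball_bound\<close> gives the factor
    \<open>4 * r + 3\<close>.\<close>
  define S' where "S' = {e\<in>S. vnorm (v e) \<le> int (2 * r + 1)}"
  have adj: "lattice_adj (u e) (v e)" if "e \<in> S" for e
    using S(2) that Upair_orient[of e] unfolding u_def v_def by (metis Upair_edge_iff subsetD)
  have split: "(edge_diff h e)\<^sup>2 \<le> (1 + \<eta>) * (edge_diff g e)\<^sup>2 + (1 + 1 / \<eta>) * d e" for e
  proof -
    define a b where "a = cutoff r (u e) * (g (u e) - g (v e))"
      and "b = (cutoff r (u e) - cutoff r (v e)) * (g (v e) - ray_limit g)"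
    have "edge_diff h e = a + b"
      by (simp add: edge_diff_def h_def a_def b_def u_def v_def algebra_simps)
    moreover have "(a + b)\<^sup>2 \<le> (1 + \<eta>) * a\<^sup>2 + (1 + 1 / \<eta>) * b\<^sup>2"
    proof -
      have "0 \<le> (\<eta> * a - b)\<^sup>2 / \<eta>" using eta by simp
      also have "\<dots> = \<eta> * a\<^sup>2 + b\<^sup>2 / \<eta> - 2 * a * b"
        using eta by (simp add: power2_eq_square field_simps)
      finally show ?thesis by (simp add: power2_eq_square algebra_simps)
    qed
    moreover have "a\<^sup>2 \<le> (edge_diff g e)\<^sup>2"
    proof -
      have "(cutoff r (u e))\<^sup>2 \<le> 1" by (simp add: cutoff_def power_le_one)
      then have "(cutoff r (u e))\<^sup>2 * (g (u e) - g (v e))\<^sup>2 \<le> 1 * (g (u e) - g (v e))\<^sup>2"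
        by (rule mult_right_mono) simp
      then show ?thesis by (simp add: a_def edge_diff_def u_def v_def power_mult_distrib)
    qed
    moreover have "b\<^sup>2 = d e" by (simp add: b_def d_def power_mult_distrib)
    ultimately show ?thesis using eta by (smt (verit) mult_left_mono)
  qed
  have zero: "d e = 0" if "e \<in> S" "e \<notin> S'" for e
  proof -
    have "vnorm (v e) > int (2 * r + 1)" using that by (simp add: S'_def)
    then have "vnorm (v e) \<ge> 2 * int r" "vnorm (u e) \<ge> 2 * int r"
      using vnorm_adj_le[of "v e" "u e"] adj[OF that(1)] lattice_adj_sym[of "u e" "v e"] by auto
    then have "real_of_int (vnorm (v e)) \<ge> 2 * real r" "real_of_int (vnorm (u e)) \<ge> 2 * real r"
      by linarith+
    then have "cutoff r (v e) = 0" "cutoff r (u e) = 0" using r by (simp_all add: cutoff_def field_simps)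
    then show ?thesis by (simp add: d_def)
  qed
  have "(\<Sum>e\<in>S. c e * d e) = (\<Sum>e\<in>S'. c e * d e)"
    using S zero by (intro sum.mono_neutral_right) (auto simp: S'_def)
  also have "\<dots> \<le> (\<Sum>e\<in>S'. (c e * (g (v e) - ray_limit g)\<^sup>2) / (real r)\<^sup>2)"
  proof (rule sum_mono)
    fix e assume "e \<in> S'"
    then have e: "e \<in> S" by (simp add: S'_def)
    have "c e * (g (v e) - ray_limit g)\<^sup>2 * (cutoff r (u e) - cutoff r (v e))\<^sup>2
        \<le> c e * (g (v e) - ray_limit g)\<^sup>2 * (1 / (real r)\<^sup>2)"
      using c[OF e] by (intro mult_left_mono cutoff_lipschitz adj e r) auto
    then show "c e * d e \<le> (c e * (g (v e) - ray_limit g)\<^sup>2) / (real r)\<^sup>2" by (simp add: d_def mult_ac)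
  qed
  also have "\<dots> = (\<Sum>e\<in>S'. c e * (g (v e) - ray_limit g)\<^sup>2) / (real r)\<^sup>2"
    by (rule sum_divide_distrib[symmetric])
  also have "\<dots> \<le> (2 * exp lam * real (lattice_degree TYPE('d)) * ((2 * real (2 * r + 1) + 1) * (ray_const * K))) / (real r)\<^sup>2"
    unfolding v_def using S c
    by (intro divide_right_mono edge_ball_bound) (auto simp: S'_def v_def)
  also have "2 * real (2 * r + 1) + 1 = 4 * real r + 3" by simp
  finally have D: "(\<Sum>e\<in>S. c e * d e)
    \<le> (2 * exp lam * real (lattice_degree TYPE('d)) * ((4 * real r + 3) * (ray_const * K))) / (real r)\<^sup>2" .
  have "energy L c S h \<le> (\<Sum>e\<in>S. c e * ((1 + \<eta>) * (edge_diff g e)\<^sup>2 + (1 + 1 / \<eta>) * d e))"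
    unfolding energy_def L_simps(3) using c split by (intro sum_mono mult_left_mono) auto
  also have "\<dots> = (1 + \<eta>) * energy L c S g + (1 + 1 / \<eta>) * (\<Sum>e\<in>S. c e * d e)"
    unfolding energy_def L_simps(3) by (simp add: sum.distrib sum_distrib_left algebra_simps)
  also have "\<dots> \<le> (1 + \<eta>) * energy L c S g
      + (1 + 1 / \<eta>) * ((2 * exp lam * real (lattice_degree TYPE('d)) * ((4 * real r + 3) * (ray_const * K))) / (real r)\<^sup>2)"
    using D eta by (intro add_left_mono mult_left_mono) auto
  finally show ?thesis by (simp add: h_def[abs_def])
qed

end

theorem lattice_approximable: "approximable_network (L :: (int \<times> (int ^ 'd), _) network)"
proof
  show "verts L = UNIV" by (simp add: L_simps)
  show "finite {e \<in> edges L. v \<in> set_uprod (ends L e)}" for v by (rule finite_L_edges_at)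
  show "cond L e > 0" if "e \<in> edges L" for e by (simp add: lattice_network_def)
  show "proper_uprod (ends L e)" if "e \<in> edges L" for e
    using that by (auto simp: L_simps lattice_adj_irrefl)
  show "\<exists>V. exhaustion L V" using exhaustion_L by blast
  fix c :: "(int \<times> (int ^ 'd)) uprod \<Rightarrow> real" and g :: "int \<times> (int ^ 'd) \<Rightarrow> real" and K \<epsilon> :: real
    and A :: "(int \<times> (int ^ 'd)) set"
  assume c: "\<And>e. e \<in> edges L \<Longrightarrow> cond L e \<le> c e \<and> c e \<le> 2 * cond L e"
    and gK: "energy_le L c g K" and A: "finite A" and eps: "\<epsilon> > 0"
  have cond_nn: "cond L e \<ge> 0" for e by (simp add: lattice_network_def)
  \<comment> \<open>The ray estimates are stated for the lattice conductances. As \<open>c\<close>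
    dominates them, the same \<open>K\<close> applies.\<close>
  have en: "energy_le L (cond L) g K"
    unfolding energy_le_def
  proof (intro allI impI, elim conjE)
    fix S :: "(int \<times> (int ^ 'd)) uprod set" assume S: "finite S" "S \<subseteq> edges L"
    have "energy L (cond L) S g \<le> energy L c S g"
      unfolding energy_def using S(2) c by (intro sum_mono mult_right_mono) auto
    also have "\<dots> \<le> K" using gK S by (simp add: energy_le_def)
    finally show "energy L (cond L) S g \<le> K" .
  qed
  have K: "K \<ge> 0" using K_nonneg[OF en] .
  define k where "k = ray_limit g"
  \<comment> \<open>Chosen so that \<open>\<eta> * K\<close> is at most half of
    \<open>\<epsilon>\<close>; the summand 1 covers the case \<open>K = 0\<close>.\<close>
  define \<eta> where "\<eta> = \<epsilon> / (2 * (K + 1))"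
  have eta: "\<eta> > 0" using eps K by (simp add: \<eta>_def)
  define Q where "Q = (1 + 1 / \<eta>) * (2 * exp lam * real (lattice_degree TYPE('d)) * (ray_const * K))"
  have Q: "Q \<ge> 0" using eta K ray_const_pos by (simp add: Q_def)
  obtain r0 :: nat where r0: "7 * Q / (\<epsilon> / 2) \<le> real r0" using real_arch_simple by blast
  \<comment> \<open>Large enough for three purposes: \<open>r\<close> is positive, the cutoff is 1
    on \<open>A\<close>, and \<open>7 * Q / r\<close> is at most half of \<open>\<epsilon>\<close>,
    where 7 comes from \<open>4 * r + 3 \<le> 7 * r\<close>.\<close>
  define r where "r = Max (insert (Suc r0) ((\<lambda>v. nat (vnorm v)) ` A))"
  have "Suc r0 \<le> r" unfolding r_def using A by (intro Max_ge) auto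
  then have r: "r > 0" "r \<ge> r0" by auto
  have rA: "vnorm v \<le> int r" if "v \<in> A" for v
  proof -
    have "nat (vnorm v) \<le> r" unfolding r_def using A that by (intro Max_ge) auto
    then show ?thesis by simp
  qed
  define h where "h v = k + cutoff r v * (g v - k)" for v
  have "\<forall>v\<in>A. h v = g v"
  proof
    fix v assume "v \<in> A"
    then have "real_of_int (vnorm v) / real r \<le> 1" using rA[of v] r by simp
    then show "h v = g v" by (simp add: h_def cutoff_def)
  qed
  moreover have "\<forall>v. v \<notin> {v. vnorm v \<le> 2 * int r} \<longrightarrow> h v = k"
  proof (intro allI impI)
    fix v :: "int \<times> (int ^ 'd)" assume "v \<notin> {v. vnorm v \<le> 2 * int r}"
    then have "2 * real r \<le> real_of_int (vnorm v)" by simp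
    then have "2 \<le> real_of_int (vnorm v) / real r" using r by (simp add: field_simps)
    then show "h v = k" by (simp add: h_def cutoff_def)
  qed
  moreover have "energy_le L c h (K + \<epsilon>)"
    unfolding energy_le_def
  proof (intro allI impI, elim conjE)
    fix S :: "(int \<times> (int ^ 'd)) uprod set" assume S: "finite S" "S \<subseteq> edges L"
    have "0 \<le> c e \<and> c e \<le> 2 * cond L e" if "e \<in> S" for e
      using c[of e] S(2) that cond_nn[of e] by auto
    note cutoff_energy[OF en S r(1) eta this]
    moreover have "(1 + 1 / \<eta>) * (2 * exp lam * real (lattice_degree TYPE('d)) * ((4 * real r + 3) * (ray_const * K)))
        = Q * (4 * real r + 3)"
      by (simp only: Q_def mult_ac)
    ultimately have "energy L c S h \<le> (1 + \<eta>) * energy L c S g + Q * (4 * real r + 3) / (real r)\<^sup>2"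
      by (simp only: h_def[abs_def] k_def)
    also have "\<dots> \<le> (1 + \<eta>) * K + \<epsilon> / 2"
    proof (rule add_mono)
      show "(1 + \<eta>) * energy L c S g \<le> (1 + \<eta>) * K"
        using gK S eta by (intro mult_left_mono) (auto simp: energy_le_def)
      have "Q * (4 * real r + 3) \<le> Q * (7 * real r)" using r Q by (intro mult_left_mono) auto
      then have "Q * (4 * real r + 3) / (real r)\<^sup>2 \<le> Q * (7 * real r) / (real r)\<^sup>2"
        by (rule divide_right_mono) simp
      also have "\<dots> = 7 * Q / real r" using r by (simp add: power2_eq_square)
      also have "\<dots> \<le> \<epsilon> / 2"
      proof -
        have "7 * Q / (\<epsilon> / 2) \<le> real r" using r0 r by linarith
        then show ?thesis using r eps by (simp add: field_simps)
      qed
      finally show "Q * (4 * real r + 3) / (real r)\<^sup>2 \<le> \<epsilon> / 2" .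
    qed
    also have "\<dots> \<le> K + \<epsilon>"
    proof -
      have "\<eta> * K \<le> \<eta> * (K + 1)" using eta by simp
      also have "\<dots> = \<epsilon> / 2" using K by (simp add: \<eta>_def field_simps)
      finally show ?thesis by (simp add: algebra_simps)
    qed
    finally show "energy L c S h \<le> K + \<epsilon>" .
  qed
  ultimately show "\<exists>g' W k. finite W \<and> (\<forall>v\<in>A. g' v = g v) \<and> (\<forall>v. v \<notin> W \<longrightarrow> g' v = k) \<and> energy_le L c g' (K + \<epsilon>)"
    using finite_vnorm_ball[of "2 * int r"] by blast
qed

end

theorem mainTheorem2:
  fixes lam :: real
  assumes "lam > 0"
  shows "is_WSF (lattice_network TYPE('d::finite) lam) (WSF (lattice_network TYPE('d) lam)) \<and>
         is_FSF (lattice_network TYPE('d) lam) (FSF (lattice_network TYPE('d) lam)) \<and>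
         WSF (lattice_network TYPE('d) lam) = FSF (lattice_network TYPE('d) lam)"
  by (rule approximable_network.WSF_eq_FSF[OF lattice_approximable[OF assms]])

end
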